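(* Let $({\bf M},F)$ be a Finsler structure. If there is a Riemannian metric $h$ on ${\bf M}$ such that the indicatrix of $F$ is left invariant under the parallel transport of the pull-back $\pi^*\nabla^h$ of its Levi-Civita connection $\nabla^h$, then the structure $({\bf M},F)$ is Berwald.
   Context: ${\bf M}$ is an $n$-dimensional smooth manifold, ${\bf N}={\bf TM}\setminus\{0\}$ is the slit tangent bundle, $\pi:{\bf N}\to{\bf M}$ the projection, $(x^i,y^i)$ natural coordinates on ${\bf TM}$ induced by coordinates $x^i$ on ${\bf M}$. A Finsler structure on ${\bf M}$ is a function $F:{\bf TM}\to[0,\infty)$, smooth on ${\bf N}$, with $F(x,\lambda y)=\lambda F(x,y)$ for $\lambda>0$, and such that $g_{ij}(x,y)=\frac12\frac{\partial^2F^2}{\partial y^i\partial y^j}$ is positive definite on ${\bf N}$. Put $A_{ijk}=\frac F2\frac{\partial g_{ij}}{\partial y^k}$, $A^i_{jk}=g^{il}A_{ljk}$, $\gamma^i_{jk}=\frac12g^{is}\left(\frac{\partial g_{sj}}{\partial x^k}-\frac{\partial g_{jk}}{\partial x^s}+\frac{\partial g_{sk}}{\partial x^j}\right)$, and $N^i_j=\gamma^i_{jk}y^k-A^i_{jk}\gamma^k_{rs}\frac{y^ry^s}{F}$. Set $\delta y^i=dy^i+N^i_jdx^j$. $\pi^*{\bf TM}\to{\bf N}$ is the pull-back bundle. A linear connection on it is given locally by 1-forms $\omega^i_j$ on ${\bf N}$, $\nabla(\pi^*\partial_j)=\omega^i_j\,\pi^*\partial_i$. The Chern connection is the unique linear connection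 on $\pi^*{\bf TM}$ with $dx^j\wedge\omega^i_j=0$ and $dg_{ij}-g_{kj}\omega^k_i-g_{ik}\omega^k_j=2A_{ijk}\frac{\delta y^k}{F}$; then $\omega^i_j=\Gamma^i_{jk}(x,y)dx^k$. $({\bf M},F)$ is Berwald if the Chern connection coefficients $\Gamma^i_{jk}$ in natural coordinates depend only on $x$. The pull-back $\pi^*\nabla^h$ of the affine connection $\nabla^h$ is the connection on $\pi^*{\bf TM}\to{\bf N}$ which has in natural coordinates the same coefficients ${}^h\Gamma^i_{jk}(x)$ as $\nabla^h$, i.e. with $\omega^i_j={}^h\Gamma^i_{jk}(x)dx^k$. The indicatrix at $x$ is ${\bf I}_x=\{y\in{\bf T}_x{\bf M}: F(x,y)=1\}$. Invariance of the indicatrix means: for every path $\gamma$ in ${\bf M}$ from $x$ to $z$, the parallel transport along $\gamma$ defined by $\nabla^h$ (equivalently by $\pi^*\nabla^h$ along lifts of $\gamma$) maps ${\bf I}_x$ onto ${\bf I}_z$. *)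

theory Defs
  imports "HOL-Analysis.Analysis"
begin

section \<open>Smooth maps between normed spaces\<close>

text \<open>Only used on open sets of finite-dimensional spaces, where requiring all iterated directional
  derivatives to exist and be differentiable is the usual notion of class $C^\infty$.\<close>

primrec Ck_on :: "nat \<Rightarrow> 'a::real_normed_vector set \<Rightarrow> ('a \<Rightarrow> 'b::real_normed_vector) \<Rightarrow> bool" where
  "Ck_on 0 S f \<longleftrightarrow> continuous_on S f"
| "Ck_on (Suc k) S f \<longleftrightarrow> (\<forall>x\<in>S. f differentiable (at x)) \<and>
     (\<forall>v. Ck_on k S (\<lambda>x. frechet_derivative f (at x) v))"

definition smooth_on :: "'a::real_normed_vector set \<Rightarrow> ('a \<Rightarrow> 'b::real_normed_vector) \<Rightarrow> bool" where
  "smooth_on S f \<longleftrightarrow> (\<forall>k. Ck_on k S f)"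


section \<open>Manifolds, tangent vectors, natural coordinates\<close>

text \<open>The manifold is the type \<open>'p\<close>, its dimension is \<open>CARD('n)\<close>. A chart is a domain together with
  a coordinate map; only the values of the map on the domain matter. The smooth structure is
  given by any smooth atlas (maximal or not).\<close>

type_synonym ('p, 'n) chart = "'p set \<times> ('p \<Rightarrow> real^'n)"

abbreviation cdom :: "('p, 'n::finite) chart \<Rightarrow> 'p set" where "cdom c \<equiv> fst c"
abbreviation cmap :: "('p, 'n::finite) chart \<Rightarrow> 'p \<Rightarrow> real^'n" where "cmap c \<equiv> snd c"
abbreviation cimg :: "('p, 'n::finite) chart \<Rightarrow> (real^'n) set" where "cimg c \<equiv> cmap c ` cdom c"

definition cinv :: "('p, 'n::finite) chart \<Rightarrow> real^'n \<Rightarrow> 'p" where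
  "cinv c = inv_into (cdom c) (cmap c)"

definition transition :: "('p, 'n::finite) chart \<Rightarrow> ('p, 'n) chart \<Rightarrow> real^'n \<Rightarrow> real^'n" where
  "transition c d = cmap d \<circ> cinv c"

definition smooth_atlas ::
    "('p::{t2_space,second_countable_topology}, 'n::finite) chart set \<Rightarrow> bool" where
  "smooth_atlas A \<longleftrightarrow>
     (\<forall>c\<in>A. open (cdom c) \<and> open (cimg c) \<and> homeomorphism (cdom c) (cimg c) (cmap c) (cinv c)) \<and>
     (\<Union>c\<in>A. cdom c) = UNIV \<and>
     (\<forall>c\<in>A. \<forall>d\<in>A. smooth_on (cmap c ` (cdom c \<inter> cdom d)) (transition c d))"

text \<open>A tangent vector at \<open>p\<close> is the family of its components in all charts around \<open>p\<close>, related by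
  the differentials of the transition maps; it is set to \<open>0\<close> on charts that do not contain \<open>p\<close>.
  The vector space operations are componentwise.\<close>

type_synonym ('p, 'n) tvec = "('p, 'n) chart \<Rightarrow> real^'n"

definition tangent_space :: "('p, 'n::finite) chart set \<Rightarrow> 'p \<Rightarrow> ('p, 'n) tvec set" where
  "tangent_space A p = {v.
     (\<forall>c\<in>A. \<forall>d\<in>A. p \<in> cdom c \<longrightarrow> p \<in> cdom d \<longrightarrow>
        v d = frechet_derivative (transition c d) (at (cmap c p)) (v c)) \<and>
     (\<forall>c. \<not> (c \<in> A \<and> p \<in> cdom c) \<longrightarrow> v c = 0)}"

abbreviation zero_tvec :: "('p, 'n::finite) tvec" where "zero_tvec \<equiv> (\<lambda>_. 0)"

text \<open>The tangent vector $y^i \partial_i$ at the point with coordinates \<open>x\<close> in the chart \<open>c\<close>.\<close>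

definition tvec_of ::
    "('p, 'n::finite) chart set \<Rightarrow> ('p, 'n) chart \<Rightarrow> real^'n \<Rightarrow> real^'n \<Rightarrow> ('p, 'n) tvec" where
  "tvec_of A c x y = (\<lambda>d. if d \<in> A \<and> cinv c x \<in> cdom d
     then frechet_derivative (transition c d) (at x) y else 0)"

text \<open>Domain of the natural coordinates $(x,y)$ on the slit tangent bundle.\<close>

definition slit :: "('p, 'n::finite) chart \<Rightarrow> ((real^'n) \<times> (real^'n)) set" where
  "slit c = cimg c \<times> (UNIV - {0})"

definition jacobian :: "('p, 'n::finite) chart \<Rightarrow> ('p, 'n) chart \<Rightarrow> real^'n \<Rightarrow> real^'n^'n" where
  "jacobian c d x = matrix (frechet_derivative (transition c d) (at x))"

text \<open>Change of natural coordinates on the tangent bundle.\<close>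

definition nat_transition :: "('p, 'n::finite) chart \<Rightarrow> ('p, 'n) chart \<Rightarrow>
    (real^'n) \<times> (real^'n) \<Rightarrow> (real^'n) \<times> (real^'n)" where
  "nat_transition c d = (\<lambda>(x, y). (transition c d x, jacobian c d x *v y))"

definition dx_partial ::
    "'n::finite \<Rightarrow> ((real^'n) \<times> (real^'n) \<Rightarrow> real) \<Rightarrow> (real^'n) \<times> (real^'n) \<Rightarrow> real" where
  "dx_partial k f z = frechet_derivative f (at z) (axis k 1, 0)"

definition dy_partial ::
    "'n::finite \<Rightarrow> ((real^'n) \<times> (real^'n) \<Rightarrow> real) \<Rightarrow> (real^'n) \<times> (real^'n) \<Rightarrow> real" where
  "dy_partial k f z = frechet_derivative f (at z) (0, axis k 1)"


section \<open>Finsler structures\<close>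

definition local_fun :: "('p, 'n::finite) chart set \<Rightarrow> ('p \<Rightarrow> ('p, 'n) tvec \<Rightarrow> real) \<Rightarrow>
    ('p, 'n) chart \<Rightarrow> (real^'n) \<times> (real^'n) \<Rightarrow> real" where
  "local_fun A F c = (\<lambda>(x, y). F (cinv c x) (tvec_of A c x y))"

text \<open>The following operators take the local expression \<open>L\<close> of \<open>F\<close> in natural coordinates.\<close>

definition fund :: "((real^'n) \<times> (real^'n) \<Rightarrow> real) \<Rightarrow> (real^'n) \<times> (real^'n) \<Rightarrow> real^'n^('n::finite)" where
  "fund L z = (\<chi> i j. 1/2 * dy_partial i (dy_partial j (\<lambda>u. (L u)\<^sup>2)) z)"

definition finsler_structure ::
    "('p, 'n::finite) chart set \<Rightarrow> ('p \<Rightarrow> ('p, 'n) tvec \<Rightarrow> real) \<Rightarrow> bool" where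
  "finsler_structure A F \<longleftrightarrow>
     (\<forall>p. \<forall>v\<in>tangent_space A p. F p v \<ge> 0) \<and>
     (\<forall>p. \<forall>v\<in>tangent_space A p. \<forall>t>0. F p (\<lambda>c. t *\<^sub>R v c) = t * F p v) \<and>
     (\<forall>c\<in>A. smooth_on (slit c) (local_fun A F c)) \<and>
     (\<forall>c\<in>A. \<forall>z\<in>slit c. \<forall>w. w \<noteq> 0 \<longrightarrow>
        (\<Sum>i\<in>UNIV. \<Sum>j\<in>UNIV. fund (local_fun A F c) z $ i $ j * w $ i * w $ j) > 0)"

definition cartan :: "((real^'n) \<times> (real^'n) \<Rightarrow> real) \<Rightarrow> (real^'n) \<times> (real^'n) \<Rightarrow>
    'n::finite \<Rightarrow> 'n \<Rightarrow> 'n \<Rightarrow> real" where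
  "cartan L z i j k = L z / 2 * dy_partial k (\<lambda>u. fund L u $ i $ j) z"

definition fund_inv :: "((real^'n) \<times> (real^'n) \<Rightarrow> real) \<Rightarrow> (real^'n) \<times> (real^'n) \<Rightarrow> real^'n^('n::finite)" where
  "fund_inv L z = matrix_inv (fund L z)"

definition cartan_up :: "((real^'n) \<times> (real^'n) \<Rightarrow> real) \<Rightarrow> (real^'n) \<times> (real^'n) \<Rightarrow>
    'n::finite \<Rightarrow> 'n \<Rightarrow> 'n \<Rightarrow> real" where
  "cartan_up L z i j k = (\<Sum>l\<in>UNIV. fund_inv L z $ i $ l * cartan L z l j k)"

definition formal_christoffel :: "((real^'n) \<times> (real^'n) \<Rightarrow> real) \<Rightarrow> (real^'n) \<times> (real^'n) \<Rightarrow>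
    'n::finite \<Rightarrow> 'n \<Rightarrow> 'n \<Rightarrow> real" where
  "formal_christoffel L z i j k = 1/2 * (\<Sum>s\<in>UNIV. fund_inv L z $ i $ s *
     (dx_partial k (\<lambda>u. fund L u $ s $ j) z
      - dx_partial s (\<lambda>u. fund L u $ j $ k) z
      + dx_partial j (\<lambda>u. fund L u $ s $ k) z))"

definition nonlinear_conn :: "((real^'n) \<times> (real^'n) \<Rightarrow> real) \<Rightarrow> (real^'n) \<times> (real^'n) \<Rightarrow>
    'n::finite \<Rightarrow> 'n \<Rightarrow> real" where
  "nonlinear_conn L z i j =
     (\<Sum>k\<in>UNIV. formal_christoffel L z i j k * snd z $ k)
     - (\<Sum>k\<in>UNIV. \<Sum>r\<in>UNIV. \<Sum>s\<in>UNIV.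
          cartan_up L z i j k * formal_christoffel L z k r s * (snd z $ r * snd z $ s / L z))"

text \<open>1-forms at a point of the slit tangent bundle are evaluated on vectors \<open>w = (\<xi>, \<eta>)\<close>, i.e. on
  $\xi^i \partial_{x^i} + \eta^i \partial_{y^i}$.\<close>

definition dx_form :: "'n::finite \<Rightarrow> (real^'n) \<times> (real^'n) \<Rightarrow> real" where
  "dx_form j w = fst w $ j"

definition delta_y :: "((real^'n) \<times> (real^'n) \<Rightarrow> real) \<Rightarrow> (real^'n) \<times> (real^'n) \<Rightarrow>
    'n::finite \<Rightarrow> (real^'n) \<times> (real^'n) \<Rightarrow> real" where
  "delta_y L z i w = snd w $ i + (\<Sum>j\<in>UNIV. nonlinear_conn L z i j * dx_form j w)"

definition wedge1 :: "('v \<Rightarrow> real) \<Rightarrow> ('v \<Rightarrow> real) \<Rightarrow> 'v \<Rightarrow> 'v \<Rightarrow> real" where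
  "wedge1 \<alpha> \<beta> u v = \<alpha> u * \<beta> v - \<alpha> v * \<beta> u"


section \<open>Linear connections on the pull-back bundle, Chern connection, Berwald structures\<close>

text \<open>\<open>\<omega> c z w $ i $ j\<close> is the value of the connection form $\omega^i_j$ of the chart \<open>c\<close>, at the
  point with natural coordinates \<open>z\<close>, on the vector \<open>w\<close>.\<close>

type_synonym ('p, 'n) conn_forms =
  "('p, 'n) chart \<Rightarrow> (real^'n) \<times> (real^'n) \<Rightarrow> (real^'n) \<times> (real^'n) \<Rightarrow> real^'n^'n"

text \<open>The last condition says that the local forms define one global connection: it is
  $J\omega = dJ + (\Phi^*\omega')J$, where $J$ is the Jacobian of the change of coordinates and
  $\Phi$ the induced change of natural coordinates.\<close>

definition linear_connection ::
    "('p, 'n::finite) chart set \<Rightarrow> ('p, 'n) conn_forms \<Rightarrow> bool" where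
  "linear_connection A \<omega> \<longleftrightarrow>
     (\<forall>c\<in>A. \<forall>z\<in>slit c. linear (\<omega> c z)) \<and>
     (\<forall>c\<in>A. \<forall>w. smooth_on (slit c) (\<lambda>z. \<omega> c z w)) \<and>
     (\<forall>c\<in>A. \<forall>d\<in>A. \<forall>z\<in>slit c. cinv c (fst z) \<in> cdom d \<longrightarrow> (\<forall>w.
        jacobian c d (fst z) ** \<omega> c z w =
          frechet_derivative (\<lambda>u. jacobian c d (fst u)) (at z) w
          + \<omega> d (nat_transition c d z) (frechet_derivative (nat_transition c d) (at z) w)
            ** jacobian c d (fst z)))"

definition chern_connection :: "('p, 'n::finite) chart set \<Rightarrow> ('p \<Rightarrow> ('p, 'n) tvec \<Rightarrow> real) \<Rightarrow>
    ('p, 'n) conn_forms \<Rightarrow> bool" where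
  "chern_connection A F \<omega> \<longleftrightarrow> linear_connection A \<omega> \<and>
     (\<forall>c\<in>A. \<forall>z\<in>slit c. let L = local_fun A F c; g = fund L in
        (\<forall>i u v. (\<Sum>j\<in>UNIV. wedge1 (dx_form j) (\<lambda>w. \<omega> c z w $ i $ j) u v) = 0) \<and>
        (\<forall>i j w. frechet_derivative (\<lambda>u. g u $ i $ j) (at z) w
             - (\<Sum>k\<in>UNIV. g z $ k $ j * \<omega> c z w $ k $ i)
             - (\<Sum>k\<in>UNIV. g z $ i $ k * \<omega> c z w $ k $ j)
           = 2 * (\<Sum>k\<in>UNIV. cartan L z i j k * (delta_y L z k w / L z))))"

lemma chern_connection_unique:
  assumes F: "finsler_structure A F" and c: "c \<in> A" and z: "z \<in> slit c"
    and w1: "chern_connection A F \<omega>" and w2: "chern_connection A F \<omega>'"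
  shows "\<omega> c z = \<omega>' c z"
proof -
  define g where "g = fund (local_fun A F c) z"
  define D where "D = (\<lambda>w. \<omega> c z w - \<omega>' c z w)"
  have pd: "(\<Sum>i\<in>UNIV. \<Sum>j\<in>UNIV. g $ i $ j * w $ i * w $ j) > 0" if "w \<noteq> 0" for w
    using F c z that unfolding finsler_structure_def g_def by blast
  have "linear (\<omega> c z)" "linear (\<omega>' c z)"
    using w1 w2 c z unfolding chern_connection_def linear_connection_def by blast+
  then have linD: "linear D"
    unfolding D_def by (rule linear_compose_sub)
  have tors: "(\<Sum>j\<in>UNIV. fst u $ j * D v $ i $ j) = (\<Sum>j\<in>UNIV. fst v $ j * D u $ i $ j)" for u v i
  proof -
    have "(\<Sum>j\<in>UNIV. wedge1 (dx_form j) (\<lambda>w. \<omega> c z w $ i $ j) u v) = 0"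
      "(\<Sum>j\<in>UNIV. wedge1 (dx_form j) (\<lambda>w. \<omega>' c z w $ i $ j) u v) = 0"
      using w1 w2 c z unfolding chern_connection_def Let_def by blast+
    then show ?thesis
      by (simp add: wedge1_def dx_form_def D_def sum_subtractf right_diff_distrib)
  qed
  have metr: "(\<Sum>k\<in>UNIV. g $ k $ j * D w $ k $ i) + (\<Sum>k\<in>UNIV. g $ i $ k * D w $ k $ j) = 0" for i j w
  proof -
    let ?L = "local_fun A F c"
    have "frechet_derivative (\<lambda>u. fund ?L u $ i $ j) (at z) w
             - (\<Sum>k\<in>UNIV. fund ?L z $ k $ j * \<omega> c z w $ k $ i)
             - (\<Sum>k\<in>UNIV. fund ?L z $ i $ k * \<omega> c z w $ k $ j)
           = 2 * (\<Sum>k\<in>UNIV. cartan ?L z i j k * (delta_y ?L z k w / ?L z))"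
       "frechet_derivative (\<lambda>u. fund ?L u $ i $ j) (at z) w
             - (\<Sum>k\<in>UNIV. fund ?L z $ k $ j * \<omega>' c z w $ k $ i)
             - (\<Sum>k\<in>UNIV. fund ?L z $ i $ k * \<omega>' c z w $ k $ j)
           = 2 * (\<Sum>k\<in>UNIV. cartan ?L z i j k * (delta_y ?L z k w / ?L z))"
      using w1 w2 c z unfolding chern_connection_def Let_def by blast+
    then show ?thesis
      by (simp add: g_def D_def sum_subtractf right_diff_distrib)
  qed
  define s where "s = (\<lambda>i k. g $ i $ k + g $ k $ i)"
  define E where "E = (\<lambda>j i l. \<Sum>k\<in>UNIV. s j k * D (axis l 1, 0) $ k $ i)"
  have anti: "E j i l = - E i j l" for i j l
  proof -
    have "E j i l + E i j l = 0"
      using metr[of j "(axis l 1, 0)" i] metr[of i "(axis l 1, 0)" j]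
      by (simp add: E_def s_def distrib_right sum.distrib)
    then show ?thesis by simp
  qed
  have dax: "(\<Sum>j\<in>UNIV. axis l (1::real) $ j * f j) = f l" for f :: "'b \<Rightarrow> real" and l
    by (simp add: axis_def if_distrib if_distribR cong: if_cong)
  have symD: "D (axis l 1, 0) $ k $ i = D (axis i 1, 0) $ k $ l" for i k l
    using tors[of "(axis l 1, 0)" "(axis i 1, 0)" k] by (simp add: dax)
  have sym: "E j i l = E j l i" for i j l
    unfolding E_def by (rule sum.cong) (simp_all only: symD[of i _ l])
  have E0: "E j i l = 0" for i j l
    using anti[of j i l] sym[of i j l] anti[of i l j] sym[of l i j] anti[of l j i] sym[of j l i]
    by linarith
  have hor: "D (axis l 1, 0) = 0" for l
  proof -
    have "D (axis l 1, 0) $ k $ i = 0" for k i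
    proof -
      let ?w = "\<chi> k. D (axis l 1, 0) $ k $ i"
      have "(\<Sum>j\<in>UNIV. ?w $ j * E j i l) =
          (\<Sum>j\<in>UNIV. \<Sum>k\<in>UNIV. g $ j $ k * ?w $ j * ?w $ k)
          + (\<Sum>j\<in>UNIV. \<Sum>k\<in>UNIV. g $ k $ j * ?w $ j * ?w $ k)"
        by (simp add: E_def s_def sum_distrib_left sum.distrib[symmetric] algebra_simps)
      also have "(\<Sum>j\<in>UNIV. \<Sum>k\<in>UNIV. g $ k $ j * ?w $ j * ?w $ k)
          = (\<Sum>j\<in>UNIV. \<Sum>k\<in>UNIV. g $ j $ k * ?w $ j * ?w $ k)"
        by (subst sum.swap) (simp add: mult.commute mult.left_commute)
      finally have "(\<Sum>j\<in>UNIV. \<Sum>k\<in>UNIV. g $ j $ k * ?w $ j * ?w $ k) = 0"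
        using E0 by simp
      then have "?w = 0" using pd[of ?w] by fastforce
      then show ?thesis by (metis vec_lambda_beta zero_index)
    qed
    then show ?thesis by (simp add: vec_eq_iff)
  qed
  have ver: "D (0, e) = 0" for e
  proof -
    have "D (0, e) $ i $ l = 0" for i l
      using tors[of "(axis l 1, 0)" "(0, e)" i] by (simp add: dax)
    then show ?thesis by (simp add: vec_eq_iff)
  qed
  have "D w = 0" for w
  proof -
    have w: "w = (\<Sum>l\<in>UNIV. fst w $ l *\<^sub>R (axis l 1, 0)) + (0, snd w)"
      by (simp add: prod_eq_iff fst_sum snd_sum vec_eq_iff axis_def if_distrib if_distribR cong: if_cong)
    have "D w = D (\<Sum>l\<in>UNIV. fst w $ l *\<^sub>R (axis l 1, 0)) + D (0, snd w)"
      unfolding linear_add[OF linD, symmetric] using arg_cong[OF w, of D] .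
    then have "D w = (\<Sum>l\<in>UNIV. fst w $ l *\<^sub>R D (axis l 1, 0)) + D (0, snd w)"
      by (simp only: linear_sum[OF linD] linear_scale[OF linD])
    then show ?thesis by (simp add: hor ver)
  qed
  then show ?thesis unfolding D_def by (simp add: fun_eq_iff)
qed

text \<open>The coefficients $\Gamma^i_{jk}$ in $\omega^i_j = \Gamma^i_{jk} dx^k$.\<close>

definition conn_coeff ::
    "('p, 'n::finite) conn_forms \<Rightarrow> ('p, 'n) chart \<Rightarrow> (real^'n) \<times> (real^'n) \<Rightarrow> 'n \<Rightarrow> 'n \<Rightarrow> 'n \<Rightarrow> real" where
  "conn_coeff \<omega> c z i j k = \<omega> c z (axis k 1, 0) $ i $ j"

text \<open>By \<open>chern_connection_unique\<close>, the existential quantifier refers to the Chern connection.\<close>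

definition berwald ::
    "('p, 'n::finite) chart set \<Rightarrow> ('p \<Rightarrow> ('p, 'n) tvec \<Rightarrow> real) \<Rightarrow> bool" where
  "berwald A F \<longleftrightarrow> (\<exists>\<omega>. chern_connection A F \<omega> \<and>
     (\<forall>c\<in>A. \<forall>x\<in>cimg c. \<forall>y y'. y \<noteq> 0 \<longrightarrow> y' \<noteq> 0 \<longrightarrow>
        (\<forall>i j k. conn_coeff \<omega> c (x, y) i j k = conn_coeff \<omega> c (x, y') i j k)))"


section \<open>Riemannian metrics, Levi-Civita connection, pull-back\<close>

definition local_metric :: "('p, 'n::finite) chart set \<Rightarrow>
    ('p \<Rightarrow> ('p, 'n) tvec \<Rightarrow> ('p, 'n) tvec \<Rightarrow> real) \<Rightarrow> ('p, 'n) chart \<Rightarrow> real^'n \<Rightarrow> real^'n^'n" where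
  "local_metric A h c x = (\<chi> i j. h (cinv c x) (tvec_of A c x (axis i 1)) (tvec_of A c x (axis j 1)))"

definition riemannian_metric :: "('p, 'n::finite) chart set \<Rightarrow>
    ('p \<Rightarrow> ('p, 'n) tvec \<Rightarrow> ('p, 'n) tvec \<Rightarrow> real) \<Rightarrow> bool" where
  "riemannian_metric A h \<longleftrightarrow>
     (\<forall>p. \<forall>u\<in>tangent_space A p. \<forall>v\<in>tangent_space A p. \<forall>w\<in>tangent_space A p. \<forall>a b.
        h p (\<lambda>c. a *\<^sub>R u c + b *\<^sub>R v c) w = a * h p u w + b * h p v w) \<and>
     (\<forall>p. \<forall>u\<in>tangent_space A p. \<forall>v\<in>tangent_space A p. h p u v = h p v u) \<and>
     (\<forall>p. \<forall>u\<in>tangent_space A p. u \<noteq> zero_tvec \<longrightarrow> h p u u > 0) \<and>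
     (\<forall>c\<in>A. smooth_on (cimg c) (local_metric A h c))"

text \<open>\<open>\<Gamma> c x i j k\<close> is the coefficient $\Gamma^i_{jk}(x)$ in the chart \<open>c\<close>:
  $\nabla\partial_j = \Gamma^i_{jk}\,dx^k \otimes \partial_i$.\<close>

type_synonym ('p, 'n) christoffel = "('p, 'n) chart \<Rightarrow> real^'n \<Rightarrow> 'n \<Rightarrow> 'n \<Rightarrow> 'n \<Rightarrow> real"

definition christoffel_form ::
    "('p, 'n::finite) christoffel \<Rightarrow> ('p, 'n) chart \<Rightarrow> real^'n \<Rightarrow> real^'n \<Rightarrow> real^'n^'n" where
  "christoffel_form \<Gamma> c x \<xi> = (\<chi> i j. \<Sum>k\<in>UNIV. \<Gamma> c x i j k * \<xi> $ k)"

definition affine_connection :: "('p, 'n::finite) chart set \<Rightarrow> ('p, 'n) christoffel \<Rightarrow> bool" where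
  "affine_connection A \<Gamma> \<longleftrightarrow>
     (\<forall>c\<in>A. \<forall>i j k. smooth_on (cimg c) (\<lambda>x. \<Gamma> c x i j k)) \<and>
     (\<forall>c\<in>A. \<forall>d\<in>A. \<forall>x\<in>cmap c ` (cdom c \<inter> cdom d). \<forall>\<xi>.
        jacobian c d x ** christoffel_form \<Gamma> c x \<xi> =
          frechet_derivative (jacobian c d) (at x) \<xi>
          + christoffel_form \<Gamma> d (transition c d x) (jacobian c d x *v \<xi>) ** jacobian c d x)"

text \<open>The torsion-free affine connection with $\nabla h = 0$.\<close>

definition levi_civita :: "('p, 'n::finite) chart set \<Rightarrow>
    ('p \<Rightarrow> ('p, 'n) tvec \<Rightarrow> ('p, 'n) tvec \<Rightarrow> real) \<Rightarrow> ('p, 'n) christoffel \<Rightarrow> bool" where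
  "levi_civita A h \<Gamma> \<longleftrightarrow> affine_connection A \<Gamma> \<and>
     (\<forall>c\<in>A. \<forall>x\<in>cimg c. \<forall>i j k. \<Gamma> c x i j k = \<Gamma> c x i k j) \<and>
     (\<forall>c\<in>A. \<forall>x\<in>cimg c. \<forall>i j k.
        frechet_derivative (\<lambda>u. local_metric A h c u $ i $ j) (at x) (axis k 1) =
          (\<Sum>l\<in>UNIV. \<Gamma> c x l i k * local_metric A h c x $ l $ j)
          + (\<Sum>l\<in>UNIV. \<Gamma> c x l j k * local_metric A h c x $ i $ l))"

definition pullback_connection :: "('p, 'n::finite) christoffel \<Rightarrow> ('p, 'n) conn_forms" where
  "pullback_connection \<Gamma> c z w = christoffel_form \<Gamma> c (fst z) (fst w)"


section \<open>Parallel transport and invariance of the indicatrix\<close>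

text \<open>\<open>(\<gamma>, V)\<close> is a smooth curve in the slit tangent bundle over the parameter interval
  \<open>[0, 1]\<close> (smooth on an open neighbourhood of it), that is, a lift of the path \<open>\<gamma>\<close>.\<close>

definition nat_coords :: "('p, 'n::finite) chart \<Rightarrow> 'p \<Rightarrow> ('p, 'n) tvec \<Rightarrow> (real^'n) \<times> (real^'n)" where
  "nat_coords c p v = (cmap c p, v c)"

definition smooth_slit_lift :: "('p::topological_space, 'n::finite) chart set \<Rightarrow>
    (real \<Rightarrow> 'p) \<Rightarrow> (real \<Rightarrow> ('p, 'n) tvec) \<Rightarrow> bool" where
  "smooth_slit_lift A \<gamma> V \<longleftrightarrow> (\<exists>T. open T \<and> {0..1} \<subseteq> T \<and> continuous_on T \<gamma> \<and>
     (\<forall>t\<in>T. V t \<in> tangent_space A (\<gamma> t) \<and> V t \<noteq> zero_tvec) \<and>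
     (\<forall>c\<in>A. smooth_on {t\<in>T. \<gamma> t \<in> cdom c} (\<lambda>t. nat_coords c (\<gamma> t) (V t))))"

text \<open>\<open>S\<close> is a section of the pull-back bundle along the curve \<open>(\<gamma>, V)\<close>; in natural coordinates
  parallelism reads $\dot S^i + \omega^i_j(\dot\sigma) S^j = 0$ with $\sigma = (\gamma, V)$.\<close>

definition parallel_along :: "('p, 'n::finite) chart set \<Rightarrow> ('p, 'n) conn_forms \<Rightarrow>
    (real \<Rightarrow> 'p) \<Rightarrow> (real \<Rightarrow> ('p, 'n) tvec) \<Rightarrow> (real \<Rightarrow> ('p, 'n) tvec) \<Rightarrow> bool" where
  "parallel_along A \<omega> \<gamma> V S \<longleftrightarrow> (\<forall>t\<in>{0..1}. S t \<in> tangent_space A (\<gamma> t) \<and>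
     (\<forall>c\<in>A. \<gamma> t \<in> cdom c \<longrightarrow>
        ((\<lambda>s. S s c) has_vector_derivative
           - (\<omega> c (nat_coords c (\<gamma> t) (V t))
                (vector_derivative (\<lambda>s. nat_coords c (\<gamma> s) (V s)) (at t)) *v S t c))
          (at t within {0..1})))"

definition parallel_transport :: "('p, 'n::finite) chart set \<Rightarrow> ('p, 'n) conn_forms \<Rightarrow>
    (real \<Rightarrow> 'p) \<Rightarrow> (real \<Rightarrow> ('p, 'n) tvec) \<Rightarrow> (('p, 'n) tvec \<times> ('p, 'n) tvec) set" where
  "parallel_transport A \<omega> \<gamma> V = {(S 0, S 1) | S. parallel_along A \<omega> \<gamma> V S}"

definition indicatrix :: "('p, 'n::finite) chart set \<Rightarrow> ('p \<Rightarrow> ('p, 'n) tvec \<Rightarrow> real) \<Rightarrow>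
    'p \<Rightarrow> ('p, 'n) tvec set" where
  "indicatrix A F p = {v \<in> tangent_space A p. F p v = 1}"

text \<open>All paths \<open>\<gamma>\<close> and all their lifts to the slit tangent bundle. For a pull-back connection the
  transport does not depend on the lift and is the parallel transport of the affine connection along
  \<open>\<gamma>\<close>. The relation is the graph of a bijection (linear differential equation), so its image is the
  image under the transport map.\<close>

definition indicatrix_invariant :: "('p::topological_space, 'n::finite) chart set \<Rightarrow>
    ('p \<Rightarrow> ('p, 'n) tvec \<Rightarrow> real) \<Rightarrow> ('p, 'n) conn_forms \<Rightarrow> bool" where
  "indicatrix_invariant A F \<omega> \<longleftrightarrow> (\<forall>\<gamma> V. smooth_slit_lift A \<gamma> V \<longrightarrow>
     parallel_transport A \<omega> \<gamma> V `` indicatrix A F (\<gamma> 0) = indicatrix A F (\<gamma> 1))"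

end

theory Submission
  imports Defs
begin

text \<open>The Chern connection turns out to be $\pi^*\nabla^h$ itself, whose coefficients depend only
  on $x$. Transporting along short coordinate segments ending at $(x,y)$, with $F(x,y)=1$, the
  invariance of the indicatrix makes $F$ constant along parallel vector fields, and differentiation
  at the end point gives $\partial_{x^k} F = \Gamma^l_{mk} y^m \partial_{y^l} F$; no existence theorem
  for the transport equation is needed, because a parallel field ending in a given vector
  is provided by surjectivity of the transport onto the indicatrix. Differentiating the
  corresponding equation for $F^2$ twice in $y$ gives
  $$\partial_{x^k} g_{ij} = g_{il}\Gamma^l_{jk} + g_{jl}\Gamma^l_{ik}
    + \Gamma^l_{mk} y^m \partial_{y^l} g_{ij}.$$
  As $\partial_{y^k} g_{ij}$ is totally symmetric and annihilated by $y^k$, this yields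
  $N^i_j = \Gamma^i_{jk} y^k$, and then it is exactly the metric condition on the Chern connection;
  torsion-freeness is that of $\nabla^h$.\<close>

section \<open>Smooth maps\<close>

text \<open>On an open set the derivative at a point sees only nearby values, so equality of
  \<open>f\<close> and \<open>g\<close> passes to their directional derivatives, to which the
  induction hypothesis applies. Every closure lemma below uses this to replace the derivative of a
  compound map by an explicit formula.\<close>

lemma Ck_on_cong:
  assumes "open S" "\<And>x. x \<in> S \<Longrightarrow> f x = g x" "Ck_on k S f"
  shows "Ck_on k S g"
  using assms(2,3)
proof (induction k arbitrary: f g)
  case 0
  then show ?case
    using continuous_on_cong[of S S f g] by simp
next
  case (Suc k)
  have df: "f differentiable (at x)" if "x \<in> S" for x
    using Suc.prems(2) that by simp
  have dg: "g differentiable (at x)" if "x \<in> S" for x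
    using df[OF that] Suc.prems(1)
    unfolding differentiable_def
    by (meson assms(1) has_derivative_transform_within_open that)
  have "frechet_derivative f (at x) = frechet_derivative g (at x)" if "x \<in> S" for x
    using frechet_derivative_transform_within_open[OF df[OF that] assms(1) that] Suc.prems(1) by blast
  then have "Ck_on k S (\<lambda>x. frechet_derivative g (at x) v)" for v
    using Suc.IH[of "\<lambda>x. frechet_derivative f (at x) v"] Suc.prems(2) by simp
  then show ?case using dg by simp
qed

lemma Ck_on_Suc_imp: "Ck_on (Suc k) S f \<Longrightarrow> Ck_on k S f"
proof (induction k arbitrary: f)
  case 0
  then show ?case
    by (auto intro!: continuous_at_imp_continuous_on differentiable_imp_continuous_within)
next
  case (Suc k)
  then show ?case by (metis Ck_on.simps(2))
qed

lemma Ck_on_const: "Ck_on k S (\<lambda>x. c)"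
  by (induction k arbitrary: c) simp_all

lemma Ck_on_bounded_linear:
  assumes B: "bounded_linear B" and S: "open S" and "Ck_on k S f"
  shows "Ck_on k S (\<lambda>x. B (f x))"
  using assms(3)
proof (induction k arbitrary: f)
  case 0
  then show ?case using bounded_linear.continuous_on[OF B] by simp
next
  case (Suc k)
  have *: "((\<lambda>x. B (f x)) has_derivative (\<lambda>v. B (frechet_derivative f (at x) v))) (at x)"
    if "x \<in> S" for x
    using Suc.prems that by (intro bounded_linear.has_derivative[OF B]) (simp flip: frechet_derivative_works)
  have "Ck_on k S (\<lambda>x. frechet_derivative (\<lambda>x. B (f x)) (at x) v)" for v
    by (rule Ck_on_cong[OF S _ Suc.IH[of "\<lambda>x. frechet_derivative f (at x) v"]])
      (use Suc.prems in \<open>auto simp: frechet_derivative_at[OF *, symmetric]\<close>)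
  then show ?case using * by (auto simp: differentiable_def)
qed

lemma Ck_on_add:
  assumes S: "open S" and "Ck_on k S f" "Ck_on k S g"
  shows "Ck_on k S (\<lambda>x. f x + g x)"
  using assms(2,3)
proof (induction k arbitrary: f g)
  case 0
  then show ?case by (simp add: continuous_on_add)
next
  case (Suc k)
  have *: "((\<lambda>x. f x + g x) has_derivative
      (\<lambda>v. frechet_derivative f (at x) v + frechet_derivative g (at x) v)) (at x)"
    if "x \<in> S" for x
    using Suc.prems that by (intro has_derivative_add) (simp_all flip: frechet_derivative_works)
  have "Ck_on k S (\<lambda>x. frechet_derivative (\<lambda>x. f x + g x) (at x) v)" for v
    by (rule Ck_on_cong[OF S _ Suc.IH[of "\<lambda>x. frechet_derivative f (at x) v"
          "\<lambda>x. frechet_derivative g (at x) v"]])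
      (use Suc.prems in \<open>auto simp: frechet_derivative_at[OF *, symmetric]\<close>)
  then show ?case using * by (auto simp: differentiable_def)
qed

lemma Ck_on_sum:
  assumes "open S" "\<And>i. i \<in> I \<Longrightarrow> Ck_on k S (f i)"
  shows "Ck_on k S (\<lambda>x. \<Sum>i\<in>I. f i x)"
  using assms(2)
  by (induction I rule: infinite_finite_induct) (auto intro: Ck_on_const Ck_on_add[OF assms(1)])

text \<open>The product rule leaves one factor undifferentiated, so the induction hypothesis is also
  applied to \<open>f\<close> and \<open>g\<close> themselves, lowered by one order through
  \<open>Ck_on_Suc_imp\<close>.\<close>

lemma Ck_on_mult:
  fixes f g :: "'a::real_normed_vector \<Rightarrow> real"
  assumes S: "open S" and "Ck_on k S f" "Ck_on k S g"
  shows "Ck_on k S (\<lambda>x. f x * g x)"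
  using assms(2,3)
proof (induction k arbitrary: f g)
  case 0
  then show ?case by (simp add: continuous_on_mult)
next
  case (Suc k)
  have *: "((\<lambda>x. f x * g x) has_derivative
      (\<lambda>v. f x * frechet_derivative g (at x) v + frechet_derivative f (at x) v * g x)) (at x)"
    if "x \<in> S" for x
    using Suc.prems that by (intro has_derivative_mult) (simp_all flip: frechet_derivative_works)
  have "Ck_on k S (\<lambda>x. frechet_derivative (\<lambda>x. f x * g x) (at x) v)" for v
    by (rule Ck_on_cong[OF S _ Ck_on_add[OF S
            Suc.IH[of f "\<lambda>x. frechet_derivative g (at x) v"]
            Suc.IH[of "\<lambda>x. frechet_derivative f (at x) v" g]]])
      (use Suc.prems Ck_on_Suc_imp[OF Suc.prems(1)] Ck_on_Suc_imp[OF Suc.prems(2)] in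
        \<open>auto simp: frechet_derivative_at[OF *, symmetric]\<close>)
  then show ?case using * by (auto simp: differentiable_def)
qed

text \<open>For an affine inner map the chain rule differentiates \<open>f\<close> in the fixed
  direction \<open>B v\<close>, so the derivative is again a composition with the same map and the
  induction closes. The two uses are restriction to a segment and composition with
  \<open>fst\<close>.\<close>

lemma Ck_on_compose_affine:
  assumes B: "bounded_linear B" and T: "open T" and "Ck_on k S f" "\<And>t. t \<in> T \<Longrightarrow> a + B t \<in> S"
  shows "Ck_on k T (\<lambda>t. f (a + B t))"
  using assms(3)
proof (induction k arbitrary: f)
  case 0
  have "continuous_on T (\<lambda>t. a + B t)"
    by (intro continuous_intros bounded_linear.continuous_on[OF B])
  then show ?case using 0 assms(4) by (auto intro: continuous_on_compose2)
next
  case (Suc k)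
  have *: "((\<lambda>t. f (a + B t)) has_derivative (\<lambda>v. frechet_derivative f (at (a + B t)) (B v))) (at t)"
    if "t \<in> T" for t
  proof -
    have 1: "((\<lambda>t. a + B t) has_derivative B) (at t)"
      using has_derivative_add[OF has_derivative_const bounded_linear_imp_has_derivative[OF B]] by simp
    have 2: "(f has_derivative frechet_derivative f (at (a + B t))) (at (a + B t))"
      using Suc.prems assms(4)[OF that] frechet_derivative_works by auto
    show ?thesis using diff_chain_at[OF 1 2] by (simp add: o_def)
  qed
  have "Ck_on k T (\<lambda>t. frechet_derivative (\<lambda>t. f (a + B t)) (at t) v)" for v
    by (rule Ck_on_cong[OF T _ Suc.IH[of "\<lambda>x. frechet_derivative f (at x) (B v)"]])
      (use Suc.prems in \<open>auto simp: frechet_derivative_at[OF *, symmetric]\<close>)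
  then show ?case using * by (auto simp: differentiable_def)
qed

section \<open>The same closure properties for smooth maps\<close>

lemma smooth_on_differentiable: "smooth_on S f \<Longrightarrow> x \<in> S \<Longrightarrow> f differentiable (at x)"
  unfolding smooth_on_def by (metis Ck_on.simps(2))

lemma smooth_on_has_derivative:
  "smooth_on S f \<Longrightarrow> x \<in> S \<Longrightarrow> (f has_derivative frechet_derivative f (at x)) (at x)"
  using smooth_on_differentiable frechet_derivative_works by blast

lemma smooth_on_frechet_derivative:
  "smooth_on S f \<Longrightarrow> smooth_on S (\<lambda>x. frechet_derivative f (at x) v)"
  unfolding smooth_on_def by (metis Ck_on.simps(2))

lemma smooth_on_continuous_on: "smooth_on S f \<Longrightarrow> continuous_on S f"
  unfolding smooth_on_def by (metis Ck_on.simps(1))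

lemma smooth_on_cong:
  "open S \<Longrightarrow> (\<And>x. x \<in> S \<Longrightarrow> f x = g x) \<Longrightarrow> smooth_on S f \<Longrightarrow> smooth_on S g"
  unfolding smooth_on_def using Ck_on_cong by blast

lemma smooth_on_const: "smooth_on S (\<lambda>x. c)"
  unfolding smooth_on_def by (simp add: Ck_on_const)

lemma smooth_on_bounded_linear:
  "bounded_linear B \<Longrightarrow> open S \<Longrightarrow> smooth_on S f \<Longrightarrow> smooth_on S (\<lambda>x. B (f x))"
  unfolding smooth_on_def using Ck_on_bounded_linear by blast

lemma smooth_on_add:
  "open S \<Longrightarrow> smooth_on S f \<Longrightarrow> smooth_on S g \<Longrightarrow> smooth_on S (\<lambda>x. f x + g x)"
  unfolding smooth_on_def using Ck_on_add by blast

lemma smooth_on_sum: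
  "open S \<Longrightarrow> (\<And>i. i \<in> I \<Longrightarrow> smooth_on S (f i)) \<Longrightarrow> smooth_on S (\<lambda>x. \<Sum>i\<in>I. f i x)"
  unfolding smooth_on_def by (simp add: Ck_on_sum)

lemma smooth_on_mult:
  fixes f g :: "'a::real_normed_vector \<Rightarrow> real"
  shows "open S \<Longrightarrow> smooth_on S f \<Longrightarrow> smooth_on S g \<Longrightarrow> smooth_on S (\<lambda>x. f x * g x)"
  unfolding smooth_on_def using Ck_on_mult by blast

lemma smooth_on_compose_affine:
  assumes "bounded_linear B" "open T" "smooth_on S f" "\<And>t. t \<in> T \<Longrightarrow> a + B t \<in> S"
  shows "smooth_on T (\<lambda>t. f (a + B t))"
  using assms Ck_on_compose_affine unfolding smooth_on_def by blast

lemma smooth_on_Pair: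
  assumes "open S" "smooth_on S f" "smooth_on S g"
  shows "smooth_on S (\<lambda>x. (f x, g x))"
proof -
  have "smooth_on S (\<lambda>x. (f x, 0) + (0, g x))"
    using assms by (intro smooth_on_add smooth_on_bounded_linear[of "\<lambda>u. (u, 0)"]
        smooth_on_bounded_linear[of "\<lambda>u. (0, u)"] bounded_linear_Pair bounded_linear_ident bounded_linear_zero)
  then show ?thesis by simp
qed

text \<open>A vector is the sum of its components placed on the axes, and each placement is linear.
  Applied twice, this reduces matrices to their entries.\<close>

lemma smooth_on_vec:
  fixes f :: "'a::real_normed_vector \<Rightarrow> 'b::euclidean_space^'k::finite"
  assumes S: "open S" and f: "\<And>i. smooth_on S (\<lambda>z. f z $ i)"
  shows "smooth_on S f"
proof -
  have "linear (axis i :: 'b \<Rightarrow> 'b^'k)" for i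
    by (rule linearI) (simp_all add: vec_eq_iff axis_def)
  then have "bounded_linear (axis i :: 'b \<Rightarrow> 'b^'k)" for i
    by (simp add: linear_conv_bounded_linear)
  then have "smooth_on S (\<lambda>z. \<Sum>i\<in>UNIV. axis i (f z $ i))"
    by (intro smooth_on_sum[OF S] smooth_on_bounded_linear[OF _ S f])
  moreover have "(\<Sum>i\<in>UNIV. axis i (f z $ i)) = f z" for z
    by (simp add: vec_eq_iff axis_def)
  ultimately show ?thesis by simp
qed

text \<open>The second difference is symmetric in \<open>v\<close> and \<open>w\<close>, whence the symmetry of second derivatives.\<close>

lemma second_difference_mvt:
  fixes f :: "'a::real_normed_vector \<Rightarrow> real"
  assumes f: "\<And>p. p \<in> cball x r \<Longrightarrow> f differentiable (at p)"
    and f': "\<And>p. p \<in> cball x r \<Longrightarrow> (\<lambda>q. frechet_derivative f (at q) v) differentiable (at p)"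
    and e: "0 < e" "e * (norm v + norm w) \<le> r"
  shows "\<exists>p\<in>cball x (e * (norm v + norm w)).
    f (x + e *\<^sub>R v + e *\<^sub>R w) - f (x + e *\<^sub>R v) - f (x + e *\<^sub>R w) + f x
      = e * (e * frechet_derivative (\<lambda>q. frechet_derivative f (at q) v) (at p) w)"
proof -
  have near: "x + s *\<^sub>R v + t *\<^sub>R w \<in> cball x (e * (norm v + norm w))"
    if "0 \<le> s" "s \<le> e" "0 \<le> t" "t \<le> e" for s t
  proof -
    have "norm (s *\<^sub>R v + t *\<^sub>R w) \<le> s * norm v + t * norm w"
      using norm_triangle_ineq[of "s *\<^sub>R v" "t *\<^sub>R w"] that by simp
    also have "\<dots> \<le> e * norm v + e * norm w"
      using that by (intro add_mono mult_right_mono) auto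
    finally show ?thesis by (simp add: dist_norm algebra_simps norm_minus_commute)
  qed
  then have near': "x + s *\<^sub>R v + t *\<^sub>R w \<in> cball x r" if "0 \<le> s" "s \<le> e" "0 \<le> t" "t \<le> e" for s t
    using e(2) that subset_cball by blast
  have dline: "((\<lambda>s. g (b + s *\<^sub>R u)) has_real_derivative frechet_derivative g (at (b + s *\<^sub>R u)) u) (at s)"
    if "g differentiable (at (b + s *\<^sub>R u))" for g :: "'a \<Rightarrow> real" and b u s
  proof -
    have 1: "((\<lambda>s. b + s *\<^sub>R u) has_derivative (\<lambda>h. h *\<^sub>R u)) (at s)"
      by (auto intro!: derivative_eq_intros)
    have 2: "(g has_derivative frechet_derivative g (at (b + s *\<^sub>R u))) (at (b + s *\<^sub>R u))"
      using that frechet_derivative_works by blast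
    have "((\<lambda>s. g (b + s *\<^sub>R u)) has_derivative (\<lambda>h. frechet_derivative g (at (b + s *\<^sub>R u)) (h *\<^sub>R u))) (at s)"
      using diff_chain_at[OF 1 2] by (simp add: o_def)
    then show ?thesis
      by (simp add: has_field_derivative_def linear_cmul[OF has_derivative_linear[OF 2]]
          mult.commute[of _ "frechet_derivative g _ _"])
  qed
  \<comment> \<open>\<open>\<phi> e - \<phi> 0\<close> is the second difference, so the mean value
    theorem in direction \<open>v\<close> yields one derivative along \<open>v\<close>, still
    differenced along \<open>w\<close>.\<close>
  define \<phi> where "\<phi> s = f (x + e *\<^sub>R w + s *\<^sub>R v) - f (x + s *\<^sub>R v)" for s
  have d\<phi>: "(\<phi> has_real_derivative frechet_derivative f (at (x + e *\<^sub>R w + s *\<^sub>R v)) v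
      - frechet_derivative f (at (x + s *\<^sub>R v)) v) (at s)" if "0 \<le> s" "s \<le> e" for s
    unfolding \<phi>_def
    using near'[of s e] near'[of s 0] e(1) that
    by (intro DERIV_diff dline f) (auto simp: add_ac)
  obtain s where s: "0 < s" "s < e" "\<phi> e - \<phi> 0 = (e - 0) * (frechet_derivative f (at (x + e *\<^sub>R w + s *\<^sub>R v)) v
      - frechet_derivative f (at (x + s *\<^sub>R v)) v)"
    using MVT2[OF e(1) d\<phi>] by auto
  \<comment> \<open>With \<open>s\<close> frozen, the remaining difference along \<open>w\<close> is
    \<open>\<psi> e - \<psi> 0\<close>; a second mean value theorem turns it into the mixed
    derivative.\<close>
  define \<psi> where "\<psi> t = frechet_derivative f (at (x + s *\<^sub>R v + t *\<^sub>R w)) v" for t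
  have d\<psi>: "(\<psi> has_real_derivative frechet_derivative (\<lambda>q. frechet_derivative f (at q) v) (at (x + s *\<^sub>R v + t *\<^sub>R w)) w) (at t)"
    if "0 \<le> t" "t \<le> e" for t
    unfolding \<psi>_def using near'[of s t] s that
    by (intro dline[where g = "\<lambda>q. frechet_derivative f (at q) v"] f') auto
  obtain t where t: "0 < t" "t < e"
    "\<psi> e - \<psi> 0 = (e - 0) * frechet_derivative (\<lambda>q. frechet_derivative f (at q) v) (at (x + s *\<^sub>R v + t *\<^sub>R w)) w"
    using MVT2[OF e(1) d\<psi>] by auto
  have "f (x + e *\<^sub>R v + e *\<^sub>R w) - f (x + e *\<^sub>R v) - f (x + e *\<^sub>R w) + f x = \<phi> e - \<phi> 0"
    by (simp add: \<phi>_def add_ac)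
  also have "\<dots> = e * (\<psi> e - \<psi> 0)"
    using s by (simp add: \<psi>_def add_ac)
  finally show ?thesis
    using t near[of s t] s by auto
qed

lemma frechet_derivative_commute:
  fixes f :: "'a::real_normed_vector \<Rightarrow> real"
  assumes S: "open S" and x: "x \<in> S" and f: "smooth_on S f"
  shows "frechet_derivative (\<lambda>q. frechet_derivative f (at q) v) (at x) w
       = frechet_derivative (\<lambda>q. frechet_derivative f (at q) w) (at x) v"
proof (rule ccontr)
  define G where "G a b p = frechet_derivative (\<lambda>q. frechet_derivative f (at q) a) (at p) b" for a b p
  assume "\<not> ?thesis"
  then have ne: "0 < \<bar>G v w x - G w v x\<bar> / 2" by (simp add: G_def)
  have cont: "isCont (G a b) x" for a b
    using smooth_on_continuous_on[OF smooth_on_frechet_derivative[OF smooth_on_frechet_derivative[OF f]]]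
      continuous_on_eq_continuous_at[OF S] x unfolding G_def by blast
  obtain r0 where r0: "0 < r0" "cball x r0 \<subseteq> S"
    using S x open_contains_cball by blast
  obtain d1 where d1: "0 < d1" "\<And>p. dist p x < d1 \<Longrightarrow> dist (G v w p) (G v w x) < \<bar>G v w x - G w v x\<bar> / 2"
    using cont[of v w] ne unfolding continuous_at_eps_delta by metis
  obtain d2 where d2: "0 < d2" "\<And>p. dist p x < d2 \<Longrightarrow> dist (G w v p) (G w v x) < \<bar>G v w x - G w v x\<bar> / 2"
    using cont[of w v] ne unfolding continuous_at_eps_delta by metis
  \<comment> \<open>Halving \<open>min d1 d2\<close> makes distance at most \<open>r\<close>
    strictly smaller than both continuity radii. In \<open>e\<close> the summand 1 keeps the
    denominator positive when \<open>v\<close> and \<open>w\<close> vanish.\<close>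
  define r where "r = min r0 (min d1 d2 / 2)"
  define e where "e = r / (norm v + norm w + 1)"
  have r: "0 < r" using r0 d1 d2 by (simp add: r_def)
  have e: "0 < e" unfolding e_def by (intro divide_pos_pos r) (simp add: add_nonneg_pos)
  have e2: "e * (norm v + norm w) \<le> r"
  proof -
    have "e * (norm v + norm w) \<le> e * (norm v + norm w + 1)" using e by simp
    also have "\<dots> = r" unfolding e_def by (simp add: add_nonneg_pos order_less_imp_not_eq2)
    finally show ?thesis .
  qed
  have sub: "cball x r \<subseteq> S" using r0 by (auto simp: r_def)
  have df: "f differentiable (at p)" "(\<lambda>q. frechet_derivative f (at q) a) differentiable (at p)" if "p \<in> cball x r" for p a
    using smooth_on_differentiable[OF f] smooth_on_differentiable[OF smooth_on_frechet_derivative[OF f]] that sub by blast+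
  obtain p where p: "p \<in> cball x (e * (norm v + norm w))"
    "f (x + e *\<^sub>R v + e *\<^sub>R w) - f (x + e *\<^sub>R v) - f (x + e *\<^sub>R w) + f x = e * (e * G v w p)"
    using second_difference_mvt[OF df(1) df(2) e e2] unfolding G_def by blast
  have e2': "e * (norm w + norm v) \<le> r" using e2 by (simp add: add.commute)
  obtain q where q: "q \<in> cball x (e * (norm w + norm v))"
    "f (x + e *\<^sub>R w + e *\<^sub>R v) - f (x + e *\<^sub>R w) - f (x + e *\<^sub>R v) + f x = e * (e * G w v q)"
    using second_difference_mvt[OF df(1) df(2) e e2'] unfolding G_def by blast
  \<comment> \<open>Both orders of differencing give the same second difference, so the mixed
    derivatives agree at the two intermediate points. Each value is within half the supposed gap of
    its value at \<open>x\<close>, a contradiction.\<close>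
  have "e * (e * G v w p) = e * (e * G w v q)"
    using p(2) q(2) by (simp only: add.assoc add.commute[of "e *\<^sub>R w" "e *\<^sub>R v"])
  then have eq: "G v w p = G w v q" using e by simp
  have "dist p x \<le> r" "dist q x \<le> r"
    using p(1) q(1) e2 e2' by (auto simp: dist_commute)
  moreover have "r < d1" "r < d2" using d1 d2 by (auto simp: r_def)
  ultimately have "dist (G v w p) (G v w x) < \<bar>G v w x - G w v x\<bar> / 2"
    "dist (G w v q) (G w v x) < \<bar>G v w x - G w v x\<bar> / 2"
    using d1(2) d2(2) by auto
  then have "dist (G v w x) (G w v x) < \<bar>G v w x - G w v x\<bar>"
    unfolding eq by (rule dist_triangle_half_r)
  then show False by (simp add: dist_real_def)
qed

section \<open>Rules for Frechet and partial derivatives\<close>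

lemma frechet_derivative_mult:
  fixes f g :: "'a::real_normed_vector \<Rightarrow> real"
  assumes "f differentiable (at z)" "g differentiable (at z)"
  shows "frechet_derivative (\<lambda>u. f u * g u) (at z) w
    = f z * frechet_derivative g (at z) w + frechet_derivative f (at z) w * g z"
  using has_derivative_mult[OF assms[unfolded frechet_derivative_works]]
  by (metis frechet_derivative_at)

lemma frechet_derivative_add:
  assumes "f differentiable (at z)" "g differentiable (at z)"
  shows "frechet_derivative (\<lambda>u. f u + g u) (at z) w
    = frechet_derivative f (at z) w + frechet_derivative g (at z) w"
  using has_derivative_add[OF assms[unfolded frechet_derivative_works]]
  by (metis frechet_derivative_at)

lemma frechet_derivative_sum:
  assumes "\<And>i. i \<in> I \<Longrightarrow> f i differentiable (at z)"
  shows "frechet_derivative (\<lambda>u. \<Sum>i\<in>I. f i u) (at z) w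
    = (\<Sum>i\<in>I. frechet_derivative (f i) (at z) w)"
  using has_derivative_sum[of I f "\<lambda>i. frechet_derivative (f i) (at z)" "at z"] assms
  by (metis frechet_derivative_at frechet_derivative_works)

lemma frechet_derivative_cong_open:
  assumes "open S" "z \<in> S" "\<And>u. u \<in> S \<Longrightarrow> f u = g u" "f differentiable (at z)"
  shows "frechet_derivative f (at z) = frechet_derivative g (at z)"
  using frechet_derivative_transform_within_open assms by metis

lemma has_derivative_fst_compose:
  assumes "f differentiable (at (fst z))"
  shows "((\<lambda>u. f (fst u)) has_derivative (\<lambda>w. frechet_derivative f (at (fst z)) (fst w))) (at z)"
  using diff_chain_at[OF has_derivative_fst[OF has_derivative_ident] assms[unfolded frechet_derivative_works]]
  by (simp add: o_def)

lemma frechet_derivative_partials: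
  fixes f :: "(real^'n) \<times> (real^'n::finite) \<Rightarrow> real"
  assumes "f differentiable (at z)"
  shows "frechet_derivative f (at z) w =
    (\<Sum>k\<in>UNIV. fst w $ k * dx_partial k f z) + (\<Sum>k\<in>UNIV. snd w $ k * dy_partial k f z)"
proof -
  have lin: "linear (frechet_derivative f (at z))"
    using assms by (rule linear_frechet_derivative)
  have "w = (\<Sum>k\<in>UNIV. fst w $ k *\<^sub>R (axis k 1, 0)) + (\<Sum>k\<in>UNIV. snd w $ k *\<^sub>R (0, axis k 1))"
    by (simp add: prod_eq_iff fst_sum snd_sum vec_eq_iff axis_def if_distrib if_distribR cong: if_cong)
  then have "frechet_derivative f (at z) w = frechet_derivative f (at z)
      ((\<Sum>k\<in>UNIV. fst w $ k *\<^sub>R (axis k 1, 0)) + (\<Sum>k\<in>UNIV. snd w $ k *\<^sub>R (0, axis k 1)))"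
    by simp
  then show ?thesis
    by (simp only: linear_add[OF lin] linear_sum[OF lin] linear_scale[OF lin] dx_partial_def dy_partial_def real_scaleR_def)
qed

lemma smooth_on_dx_partial: "smooth_on S f \<Longrightarrow> smooth_on S (dx_partial k f)"
  unfolding dx_partial_def[abs_def] by (rule smooth_on_frechet_derivative)

lemma smooth_on_dy_partial: "smooth_on S f \<Longrightarrow> smooth_on S (dy_partial k f)"
  unfolding dy_partial_def[abs_def] by (rule smooth_on_frechet_derivative)

lemma dy_partial_commute:
  assumes "open S" "z \<in> S" "smooth_on S f"
  shows "dy_partial i (dy_partial j f) z = dy_partial j (dy_partial i f) z"
  using frechet_derivative_commute[OF assms] by (simp add: dy_partial_def[abs_def])

lemma dx_dy_partial_commute:
  assumes "open S" "z \<in> S" "smooth_on S f"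
  shows "dx_partial i (dy_partial j f) z = dy_partial j (dx_partial i f) z"
  using frechet_derivative_commute[OF assms] by (simp add: dx_partial_def[abs_def] dy_partial_def[abs_def])

lemma dy_partial_cong:
  assumes "open S" "z \<in> S" "\<And>u. u \<in> S \<Longrightarrow> f u = g u" "smooth_on S f"
  shows "dy_partial i f z = dy_partial i g z"
  using frechet_derivative_cong_open[OF assms(1-3)] smooth_on_differentiable[OF assms(4,2)]
  by (simp add: dy_partial_def)

section \<open>Homogeneous functions\<close>

text \<open>Differentiate \<open>t \<mapsto> f (x, t *\<^sub>R y)\<close> at \<open>t = 1\<close>,
  once by the chain rule and once as a power of \<open>t\<close>. The two agree on the open set of
  positive \<open>t\<close>, which suffices at 1.\<close>

lemma euler_homogeneous:
  fixes f :: "(real^'n) \<times> (real^'n::finite) \<Rightarrow> real"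
  assumes "f differentiable (at (x, y))" "\<And>t. t > 0 \<Longrightarrow> f (x, t *\<^sub>R y) = t ^ k * f (x, y)"
  shows "(\<Sum>i\<in>UNIV. y $ i * dy_partial i f (x, y)) = real k * f (x, y)"
proof -
  have 1: "((\<lambda>t. (x, t *\<^sub>R y)) has_derivative (\<lambda>h. (0, h *\<^sub>R y))) (at 1)"
    by (auto intro!: derivative_eq_intros)
  have "((\<lambda>t. f (x, t *\<^sub>R y)) has_derivative (\<lambda>h. frechet_derivative f (at (x, y)) (0, h *\<^sub>R y))) (at 1)"
    using diff_chain_at[OF 1, of f "frechet_derivative f (at (x, y))"] assms(1)
    by (simp add: o_def flip: frechet_derivative_works)
  moreover have "((\<lambda>t. t ^ k * f (x, y)) has_derivative (\<lambda>h. real k * h * f (x, y))) (at 1)"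
    by (auto intro!: derivative_eq_intros)
  then have "((\<lambda>t. f (x, t *\<^sub>R y)) has_derivative (\<lambda>h. real k * h * f (x, y))) (at 1)"
    by (rule has_derivative_transform_within_open[where s = "{0<..}"]) (auto simp: assms(2))
  ultimately have "(\<lambda>h. frechet_derivative f (at (x, y)) (0, h *\<^sub>R y)) = (\<lambda>h. real k * h * f (x, y))"
    by (rule has_derivative_unique)
  from fun_cong[OF this, of 1] show ?thesis
    by (simp add: frechet_derivative_partials[OF assms(1)])
qed

text \<open>For a fixed \<open>t\<close>, differentiate
  \<open>u \<mapsto> f (fst u, t *\<^sub>R snd u)\<close> by the chain rule and by homogeneity, then
  compare.\<close>

lemma frechet_derivative_homogeneous:
  fixes f :: "(real^'n) \<times> (real^'n::finite) \<Rightarrow> real"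
  assumes S: "open S" "(x, y) \<in> S" and f: "\<And>z. z \<in> S \<Longrightarrow> f differentiable (at z)"
    and t: "t > 0" "(x, t *\<^sub>R y) \<in> S"
    and hom: "\<And>x y. (x, y) \<in> S \<Longrightarrow> f (x, t *\<^sub>R y) = t ^ k * f (x, y)"
  shows "frechet_derivative f (at (x, t *\<^sub>R y)) (\<xi>, t *\<^sub>R \<eta>) = t ^ k * frechet_derivative f (at (x, y)) (\<xi>, \<eta>)"
proof -
  have 1: "((\<lambda>u. (fst u, t *\<^sub>R snd u)) has_derivative (\<lambda>u. (fst u, t *\<^sub>R snd u))) (at (x, y))"
    by (auto intro!: derivative_eq_intros)
  have "((\<lambda>u. f (fst u, t *\<^sub>R snd u)) has_derivative
      (\<lambda>u. frechet_derivative f (at (x, t *\<^sub>R y)) (fst u, t *\<^sub>R snd u))) (at (x, y))"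
    using diff_chain_at[OF 1, of f "frechet_derivative f (at (x, t *\<^sub>R y))"] f[OF t(2)]
    by (simp add: o_def flip: frechet_derivative_works)
  moreover have "((\<lambda>u. t ^ k * f u) has_derivative (\<lambda>u. t ^ k * frechet_derivative f (at (x, y)) u)) (at (x, y))"
    using f[OF S(2)] by (auto intro!: has_derivative_mult_right simp flip: frechet_derivative_works)
  then have "((\<lambda>u. f (fst u, t *\<^sub>R snd u)) has_derivative (\<lambda>u. t ^ k * frechet_derivative f (at (x, y)) u)) (at (x, y))"
    by (rule has_derivative_transform_within_open[where s = S]) (use S hom in auto)
  ultimately have "(\<lambda>u. frechet_derivative f (at (x, t *\<^sub>R y)) (fst u, t *\<^sub>R snd u))
      = (\<lambda>u. t ^ k * frechet_derivative f (at (x, y)) u)"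
    by (rule has_derivative_unique)
  from fun_cong[OF this, of "(\<xi>, \<eta>)"] show ?thesis by simp
qed

text \<open>A purely vertical direction is itself multiplied by \<open>t\<close>; cancelling this
  factor lowers the degree by one.\<close>

lemma dy_partial_homogeneous:
  fixes f :: "(real^'n) \<times> (real^'n::finite) \<Rightarrow> real"
  assumes "open S" "(x, y) \<in> S" "\<And>z. z \<in> S \<Longrightarrow> f differentiable (at z)"
    and t: "t > 0" "(x, t *\<^sub>R y) \<in> S"
    and "\<And>x y. (x, y) \<in> S \<Longrightarrow> f (x, t *\<^sub>R y) = t ^ Suc k * f (x, y)"
  shows "dy_partial i f (x, t *\<^sub>R y) = t ^ k * dy_partial i f (x, y)"
proof -
  have lin: "linear (frechet_derivative f (at (x, t *\<^sub>R y)))"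
    using assms(3)[OF t(2)] by (rule linear_frechet_derivative)
  have "frechet_derivative f (at (x, t *\<^sub>R y)) (0, t *\<^sub>R axis i 1)
      = t ^ Suc k * frechet_derivative f (at (x, y)) (0, axis i 1)"
    by (rule frechet_derivative_homogeneous[OF assms])
  moreover have "(0, t *\<^sub>R axis i 1) = t *\<^sub>R (0 :: real^'n, axis i (1::real))" by simp
  ultimately have "t * dy_partial i f (x, t *\<^sub>R y) = t * (t ^ k * dy_partial i f (x, y))"
    using linear_scale[OF lin, of t "(0, axis i 1)"]
    by (simp add: dy_partial_def del: scaleR_Pair)
  then show ?thesis using t(1) by simp
qed

section \<open>Finsler functions in natural coordinates\<close>

text \<open>One natural coordinate domain of a Finsler structure. \<open>S\<close> is a parameter
  tied to \<open>U\<close> by an equation, so that interpretations speak of \<open>slit c\<close>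
  directly.\<close>

locale finsler_chart =
  fixes U :: "(real^'n::finite) set" and L :: "(real^'n) \<times> (real^'n) \<Rightarrow> real"
    and S :: "((real^'n) \<times> (real^'n)) set"
  assumes S_def: "S = U \<times> (UNIV - {0})"
    and open_U: "open U"
    and smooth_L: "smooth_on S L"
    and L_nonneg: "\<And>z. z \<in> S \<Longrightarrow> L z \<ge> 0"
    and L_hom: "\<And>x y t. (x, y) \<in> S \<Longrightarrow> t > 0 \<Longrightarrow> L (x, t *\<^sub>R y) = t * L (x, y)"
    and fund_pos: "\<And>z w. z \<in> S \<Longrightarrow> w \<noteq> 0 \<Longrightarrow>
        (\<Sum>i\<in>UNIV. \<Sum>j\<in>UNIV. fund L z $ i $ j * w $ i * w $ j) > 0"
begin

definition E where "E z = (L z)\<^sup>2"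

lemma open_S: "open S"
  unfolding S_def by (intro open_Times open_U open_Diff open_UNIV closed_singleton)

lemma scale_S: "(x, y) \<in> S \<Longrightarrow> t > 0 \<Longrightarrow> (x, t *\<^sub>R y) \<in> S"
  by (simp add: S_def)

lemma smooth_E: "smooth_on S E"
  using smooth_on_mult[OF open_S smooth_L smooth_L] by (simp add: E_def[abs_def] power2_eq_square)

lemma fund_E: "fund L z $ i $ j = 1/2 * dy_partial i (dy_partial j E) z"
  by (simp add: fund_def E_def[abs_def])

lemma smooth_fund: "smooth_on S (\<lambda>u. fund L u $ i $ j)"
  unfolding fund_E
  by (intro smooth_on_mult open_S smooth_on_const) (simp add: smooth_on_dy_partial smooth_E)

lemma diff_S: "smooth_on S f \<Longrightarrow> z \<in> S \<Longrightarrow> f differentiable (at z)"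
  by (rule smooth_on_differentiable)

lemma E_hom: "(x, y) \<in> S \<Longrightarrow> t > 0 \<Longrightarrow> E (x, t *\<^sub>R y) = t ^ 2 * E (x, y)"
  by (simp add: E_def L_hom power_mult_distrib)

lemma dE_hom: "(x, y) \<in> S \<Longrightarrow> t > 0 \<Longrightarrow> dy_partial i E (x, t *\<^sub>R y) = t ^ 1 * dy_partial i E (x, y)"
  by (rule dy_partial_homogeneous[OF open_S])
    (auto simp: scale_S diff_S smooth_E E_hom numeral_2_eq_2)

lemma ddE_hom: "(x, y) \<in> S \<Longrightarrow> t > 0 \<Longrightarrow>
    dy_partial i (dy_partial j E) (x, t *\<^sub>R y) = t ^ 0 * dy_partial i (dy_partial j E) (x, y)"
  by (rule dy_partial_homogeneous[OF open_S])
    (auto simp: scale_S diff_S smooth_E smooth_on_dy_partial dE_hom)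

lemma fund_sym: "z \<in> S \<Longrightarrow> fund L z $ i $ j = fund L z $ j $ i"
  unfolding fund_E using dy_partial_commute[OF open_S _ smooth_E] by simp

lemma dy_fund_E: "z \<in> S \<Longrightarrow> dy_partial k (\<lambda>u. fund L u $ i $ j) z
    = 1/2 * dy_partial k (dy_partial i (dy_partial j E)) z"
  unfolding fund_E dy_partial_def[of k]
  by (subst frechet_derivative_mult) (auto intro!: diff_S smooth_on_dy_partial smooth_E)

lemma dy_fund_sym: "z \<in> S \<Longrightarrow> dy_partial k (\<lambda>u. fund L u $ i $ j) z = dy_partial k (\<lambda>u. fund L u $ j $ i) z"
  by (rule dy_partial_cong[OF open_S]) (auto simp: fund_sym smooth_fund)

text \<open>Up to the factor 1/2 both sides are third derivatives of \<open>E\<close> in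
  \<open>y\<close>. Commuting the outer two derivatives, together with the symmetry of
  \<open>fund\<close>, generates all permutations of the three indices.\<close>

lemma dy_fund_swap:
  assumes z: "z \<in> S"
  shows "dy_partial k (\<lambda>u. fund L u $ i $ j) z = dy_partial j (\<lambda>u. fund L u $ i $ k) z"
proof -
  have "dy_partial k (\<lambda>u. fund L u $ i $ j) z = dy_partial i (\<lambda>u. fund L u $ k $ j) z" for i j k
    unfolding dy_fund_E[OF z] by (subst dy_partial_commute[OF open_S z]) (auto intro: smooth_on_dy_partial smooth_E)
  then show ?thesis using dy_fund_sym[OF z] by metis
qed

text \<open>The fundamental tensor has degree 0 in \<open>y\<close>, so this is Euler's relation
  with \<open>k = 0\<close>.\<close>

lemma dy_fund_y: "(x, y) \<in> S \<Longrightarrow> (\<Sum>k\<in>UNIV. y $ k * dy_partial k (\<lambda>u. fund L u $ i $ j) (x, y)) = 0"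
  by (subst euler_homogeneous[where k = 0])
    (use diff_S[OF smooth_fund] in \<open>auto simp: fund_E ddE_hom\<close>)

text \<open>Euler's relation is used twice, in degree 1 for the first derivatives of
  \<open>E\<close> and in degree 2 for \<open>E\<close>; the resulting factor 2 cancels the 1/2 in
  \<open>fund\<close>.\<close>

lemma fund_yy:
  assumes z: "(x, y) \<in> S"
  shows "(\<Sum>i\<in>UNIV. \<Sum>j\<in>UNIV. fund L (x, y) $ i $ j * y $ i * y $ j) = E (x, y)"
proof -
  have 1: "(\<Sum>i\<in>UNIV. y $ i * dy_partial i (dy_partial j E) (x, y)) = real 1 * dy_partial j E (x, y)" for j
    by (rule euler_homogeneous) (use z in \<open>auto intro!: diff_S smooth_on_dy_partial smooth_E simp: dE_hom\<close>)
  have 2: "(\<Sum>j\<in>UNIV. y $ j * dy_partial j E (x, y)) = real 2 * E (x, y)"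
    by (rule euler_homogeneous) (use z in \<open>auto intro!: diff_S smooth_E simp: E_hom\<close>)
  have "(\<Sum>i\<in>UNIV. \<Sum>j\<in>UNIV. fund L (x, y) $ i $ j * y $ i * y $ j)
    = (\<Sum>j\<in>UNIV. y $ j * (1/2 * (\<Sum>i\<in>UNIV. y $ i * dy_partial i (dy_partial j E) (x, y))))"
    by (subst sum.swap) (simp add: fund_E sum_distrib_left mult_ac)
  also have "\<dots> = 1/2 * (\<Sum>j\<in>UNIV. y $ j * dy_partial j E (x, y))"
    unfolding 1 by (simp add: sum_distrib_left mult_ac)
  finally show ?thesis unfolding 2 by simp
qed

text \<open>By \<open>fund_yy\<close>, positive definiteness makes the square of \<open>L\<close>
  positive at nonzero \<open>y\<close>. This justifies every later division by
  \<open>L\<close>.\<close>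

lemma L_pos: "z \<in> S \<Longrightarrow> L z > 0"
  using fund_pos[of z "snd z"] fund_yy[of "fst z" "snd z"] L_nonneg[of z]
  by (cases z) (auto simp: S_def E_def)

lemma fund_inv_fund:
  assumes z: "z \<in> S"
  shows "(\<Sum>s\<in>UNIV. fund_inv L z $ i $ s * (\<Sum>l\<in>UNIV. fund L z $ s $ l * v $ l)) = v $ i"
proof -
  have "w = 0" if "fund L z *v w = 0" for w
  proof (rule ccontr)
    assume "w \<noteq> 0"
    then have "0 < (\<Sum>i\<in>UNIV. \<Sum>j\<in>UNIV. fund L z $ i $ j * w $ i * w $ j)"
      using fund_pos z by blast
    also have "\<dots> = (\<Sum>i\<in>UNIV. w $ i * (fund L z *v w) $ i)"
      by (simp add: matrix_vector_mult_def sum_distrib_left mult_ac)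
    finally show False using that by simp
  qed
  then have "invertible (fund L z)"
    by (simp add: invertible_left_inverse matrix_left_invertible_ker)
  then have "fund_inv L z ** fund L z = mat 1"
    \<comment> \<open>\<open>matrix_inv\<close> is a choice among two-sided inverses, so its
      defining property needs the invertibility obtained from the trivial kernel.\<close>
    unfolding fund_inv_def matrix_inv_def invertible_def by (rule someI2_ex) simp
  then have "fund_inv L z *v (fund L z *v v) = v"
    by (simp add: matrix_vector_mul_assoc)
  then have "(fund_inv L z *v (fund L z *v v)) $ i = v $ i" by simp
  then show ?thesis by (simp add: matrix_vector_mult_def)
qed

end

section \<open>Finsler functions constant along the horizontal directions of an affine
  connection\<close>

text \<open>The assumption \<open>horizontal\<close> is the infinitesimal form of indicatrix
  invariance: the square of \<open>L\<close> is annihilated by the horizontal lifts of the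
  coordinate fields. It is derived from parallel transport further below.\<close>

locale finsler_invariant_chart = finsler_chart U L S for U :: "(real^'n::finite) set" and L S +
  fixes \<Gamma> :: "real^'n \<Rightarrow> 'n \<Rightarrow> 'n \<Rightarrow> 'n \<Rightarrow> real"
  assumes smooth_\<Gamma>: "\<And>i j k. smooth_on U (\<lambda>x. \<Gamma> x i j k)"
    and \<Gamma>_sym: "\<And>x i j k. x \<in> U \<Longrightarrow> \<Gamma> x i j k = \<Gamma> x i k j"
    and horizontal: "\<And>z k. z \<in> S \<Longrightarrow> dx_partial k (\<lambda>u. (L u)\<^sup>2) z
        = (\<Sum>l\<in>UNIV. (\<Sum>m\<in>UNIV. \<Gamma> (fst z) l m k * snd z $ m) * dy_partial l (\<lambda>u. (L u)\<^sup>2) z)"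
begin

text \<open>The nonlinear connection induced by \<open>\<Gamma>\<close>, linear in \<open>y\<close>;
  \<open>nonlinear_conn_eq\<close> identifies it with that of the Finsler structure.\<close>

definition N where "N z l k = (\<Sum>m\<in>UNIV. \<Gamma> (fst z) l m k * snd z $ m)"

lemma fst_S: "z \<in> S \<Longrightarrow> fst z \<in> U"
  by (auto simp: S_def)

lemma N_sym: "z \<in> S \<Longrightarrow> N z l k = (\<Sum>m\<in>UNIV. \<Gamma> (fst z) l k m * snd z $ m)"
  unfolding N_def using \<Gamma>_sym fst_S by (intro sum.cong) auto

lemma \<Gamma>_deriv:
  "z \<in> S \<Longrightarrow> ((\<lambda>u. \<Gamma> (fst u) l m k) has_derivative
      (\<lambda>w. frechet_derivative (\<lambda>x. \<Gamma> x l m k) (at (fst z)) (fst w))) (at z)"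
  by (rule has_derivative_fst_compose) (use smooth_on_differentiable[OF smooth_\<Gamma>] fst_S in auto)

lemma \<Gamma>_differentiable: "z \<in> S \<Longrightarrow> (\<lambda>u. \<Gamma> (fst u) l m k) differentiable (at z)"
  using \<Gamma>_deriv differentiableI by blast

lemma \<Gamma>_dy: "z \<in> S \<Longrightarrow> frechet_derivative (\<lambda>u. \<Gamma> (fst u) l m k) (at z) (0, v) = 0"
  using frechet_derivative_at[OF \<Gamma>_deriv, of z l m k, symmetric]
    linear_0[OF linear_frechet_derivative[OF smooth_on_differentiable[OF smooth_\<Gamma>[of l m k] fst_S[of z]]]]
  by simp

lemma snd_deriv: "((\<lambda>u. snd u $ m) has_derivative (\<lambda>w. snd w $ m)) (at z)"
  by (intro bounded_linear_imp_has_derivative bounded_linear_compose[OF bounded_linear_vec_nth bounded_linear_snd])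

lemma N_differentiable: "z \<in> S \<Longrightarrow> (\<lambda>u. N u l k) differentiable (at z)"
  unfolding N_def
  by (auto intro!: differentiable_sum differentiable_mult \<Gamma>_differentiable differentiableI[OF snd_deriv])

lemma N_dy:
  assumes z: "z \<in> S"
  shows "frechet_derivative (\<lambda>u. N u l k) (at z) (0, axis j 1) = \<Gamma> (fst z) l j k"
proof -
  have "frechet_derivative (\<lambda>u. N u l k) (at z) (0, axis j 1)
      = (\<Sum>m\<in>UNIV. \<Gamma> (fst z) l m k * axis j 1 $ m)"
    unfolding N_def using z
    by (subst frechet_derivative_sum)
      (simp_all add: frechet_derivative_mult \<Gamma>_differentiable differentiableI[OF snd_deriv] \<Gamma>_dy
        differentiable_mult frechet_derivative_at[OF snd_deriv, symmetric])
  then show ?thesis by (simp add: axis_def if_distrib cong: if_cong)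
qed

lemma dx_E: "z \<in> S \<Longrightarrow> dx_partial k E z = (\<Sum>l\<in>UNIV. N z l k * dy_partial l E z)"
  using horizontal unfolding E_def[abs_def] N_def by simp

lemma smooth_dE: "smooth_on S (dy_partial l E)" "smooth_on S (dy_partial i (dy_partial l E))"
  by (simp_all add: smooth_on_dy_partial smooth_E)

lemma dy_dx_E:
  assumes z: "z \<in> S"
  shows "dy_partial j (dx_partial k E) z
    = (\<Sum>l\<in>UNIV. \<Gamma> (fst z) l j k * dy_partial l E z + N z l k * dy_partial j (dy_partial l E) z)"
proof -
  have "dy_partial j (dx_partial k E) z = dy_partial j (\<lambda>z. \<Sum>l\<in>UNIV. N z l k * dy_partial l E z) z"
    by (rule dy_partial_cong[OF open_S z]) (auto simp: dx_E smooth_on_dx_partial smooth_E)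
  also have "\<dots> = (\<Sum>l\<in>UNIV. N z l k * dy_partial j (dy_partial l E) z + \<Gamma> (fst z) l j k * dy_partial l E z)"
    unfolding dy_partial_def[of j] using z
    by (subst frechet_derivative_sum)
      (simp_all add: frechet_derivative_mult differentiable_mult N_differentiable diff_S[OF smooth_dE(1)] N_dy)
  finally show ?thesis by (simp add: add.commute)
qed

text \<open>Differentiate \<open>dy_dx_E\<close> once more. Since \<open>N\<close> is linear in
  \<open>y\<close>, its derivative is \<open>\<Gamma>\<close>, which depends on \<open>x\<close>
  alone, so no further terms arise.\<close>

lemma dy_dy_dx_E:
  assumes z: "z \<in> S"
  shows "dy_partial i (dy_partial j (dx_partial k E)) z
    = (\<Sum>l\<in>UNIV. \<Gamma> (fst z) l j k * dy_partial i (dy_partial l E) z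
         + (N z l k * dy_partial i (dy_partial j (dy_partial l E)) z + \<Gamma> (fst z) l i k * dy_partial j (dy_partial l E) z))"
proof -
  have "dy_partial i (dy_partial j (dx_partial k E)) z = dy_partial i (\<lambda>z.
    \<Sum>l\<in>UNIV. \<Gamma> (fst z) l j k * dy_partial l E z + N z l k * dy_partial j (dy_partial l E) z) z"
    by (rule dy_partial_cong[OF open_S z]) (auto simp: dy_dx_E smooth_on_dx_partial smooth_on_dy_partial smooth_E)
  also have "\<dots> = (\<Sum>l\<in>UNIV. \<Gamma> (fst z) l j k * dy_partial i (dy_partial l E) z
         + (N z l k * dy_partial i (dy_partial j (dy_partial l E)) z + \<Gamma> (fst z) l i k * dy_partial j (dy_partial l E) z))"
    unfolding dy_partial_def[of i] using z
    by (subst frechet_derivative_sum)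
      (simp_all add: frechet_derivative_add frechet_derivative_mult differentiable_add differentiable_mult
        N_differentiable diff_S[OF smooth_dE(1)] diff_S[OF smooth_dE(2)] N_dy \<Gamma>_dy \<Gamma>_differentiable)
  finally show ?thesis .
qed

text \<open>The x-derivative is moved inside both y-derivatives, where \<open>dx_E\<close> is
  available. Total symmetry of the third derivatives then turns the last term into the derivative of
  the fundamental tensor along \<open>N\<close>.\<close>

lemma dx_fund:
  assumes z: "z \<in> S"
  shows "dx_partial k (\<lambda>u. fund L u $ i $ j) z
    = (\<Sum>l\<in>UNIV. fund L z $ i $ l * \<Gamma> (fst z) l j k) + (\<Sum>l\<in>UNIV. fund L z $ j $ l * \<Gamma> (fst z) l i k)
      + (\<Sum>l\<in>UNIV. N z l k * dy_partial l (\<lambda>u. fund L u $ i $ j) z)"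
proof -
  have "dx_partial k (\<lambda>u. fund L u $ i $ j) z = 1/2 * dx_partial k (dy_partial i (dy_partial j E)) z"
    unfolding fund_E dx_partial_def[of k] using z
    by (subst frechet_derivative_mult) (auto intro!: diff_S smooth_on_dy_partial smooth_E)
  also have "dx_partial k (dy_partial i (dy_partial j E)) z = dy_partial i (dx_partial k (dy_partial j E)) z"
    by (rule dx_dy_partial_commute[OF open_S z smooth_dE(1)])
  also have "\<dots> = dy_partial i (dy_partial j (dx_partial k E)) z"
    by (rule dy_partial_cong[OF open_S z])
      (auto simp: dx_dy_partial_commute[OF open_S _ smooth_E] smooth_on_dx_partial smooth_dE)
  finally have eq: "dx_partial k (\<lambda>u. fund L u $ i $ j) z = (\<Sum>l\<in>UNIV. \<Gamma> (fst z) l j k * fund L z $ i $ l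
         + (N z l k * dy_partial i (\<lambda>u. fund L u $ j $ l) z + \<Gamma> (fst z) l i k * fund L z $ j $ l))"
    unfolding dy_dy_dx_E[OF z] dy_fund_E[OF z] by (simp add: fund_E sum_distrib_left algebra_simps)
  have "dy_partial i (\<lambda>u. fund L u $ j $ l) z = dy_partial l (\<lambda>u. fund L u $ i $ j) z" for l
    using dy_fund_sym[OF z] dy_fund_swap[OF z] by metis
  then show ?thesis unfolding eq by (simp add: sum.distrib algebra_simps)
qed

text \<open>\<open>L z / 2\<close> times this is \<open>cartan L z i j k\<close>.\<close>

abbreviation (input) C where "C z i j k \<equiv> dy_partial k (\<lambda>u. fund L u $ i $ j) z"

lemma C_y:
  assumes z: "z \<in> S"
  shows "(\<Sum>k\<in>UNIV. snd z $ k * C z i j k) = 0" "(\<Sum>k\<in>UNIV. snd z $ k * C z i k j) = 0"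
    "(\<Sum>k\<in>UNIV. snd z $ k * C z k i j) = 0"
proof -
  show 1: "(\<Sum>k\<in>UNIV. snd z $ k * C z i j k) = 0" for i j
    using dy_fund_y[of "fst z" "snd z"] z by simp
  have "C z i k j = C z i j k" "C z k i j = C z i j k" for k
    using dy_fund_sym[OF z] dy_fund_swap[OF z] by metis+
  then show "(\<Sum>k\<in>UNIV. snd z $ k * C z i k j) = 0" "(\<Sum>k\<in>UNIV. snd z $ k * C z k i j) = 0"
    using 1 by simp_all
qed

text \<open>The spray of \<open>\<Gamma>\<close>, quadratic in \<open>y\<close>.\<close>

definition N0 where "N0 z l = (\<Sum>k\<in>UNIV. N z l k * snd z $ k)"

text \<open>Insert \<open>dx_fund\<close> into the Christoffel formula. The \<open>\<Gamma>\<close>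
  terms combine as for a Levi-Civita connection and give \<open>N\<close> after inverting the
  metric. Of the three Cartan terms, two vanish because \<open>y\<close> meets a slot of
  \<open>C\<close>; in the third it meets \<open>N\<close> and leaves \<open>N0\<close>.\<close>

lemma christoffel_y:
  assumes z: "z \<in> S"
  shows "(\<Sum>k\<in>UNIV. formal_christoffel L z i j k * snd z $ k)
    = N z i j + 1/2 * (\<Sum>s\<in>UNIV. fund_inv L z $ i $ s * (\<Sum>l\<in>UNIV. N0 z l * C z s j l))"
proof -
  define G where "G s j k = (\<Sum>l\<in>UNIV. fund L z $ s $ l * \<Gamma> (fst z) l j k)" for s j k
  define M where "M s j k = (\<Sum>l\<in>UNIV. N z l k * C z s j l)" for s j k
  have dx: "dx_partial k (\<lambda>u. fund L u $ i $ j) z = G i j k + G j i k + M i j k" for i j k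
    unfolding dx_fund[OF z] G_def M_def ..
  have Gsym: "G s j k = G s k j" for s j k
    unfolding G_def using \<Gamma>_sym[OF fst_S[OF z]] by simp
  \<comment> \<open>By \<open>Gsym\<close> the six \<open>G\<close> terms reduce to
    \<open>2 * G s j k\<close>: one pair coincides and the other two cancel.\<close>
  have P: "dx_partial k (\<lambda>u. fund L u $ s $ j) z - dx_partial s (\<lambda>u. fund L u $ j $ k) z
      + dx_partial j (\<lambda>u. fund L u $ s $ k) z = 2 * G s j k + M s j k - M j k s + M s k j" for s j k
    unfolding dx using Gsym[of s j k] Gsym[of k j s] Gsym[of j k s] by simp
  have M0: "(\<Sum>k\<in>UNIV. M j k s * snd z $ k) = 0" for j s
  proof -
    have "(\<Sum>k\<in>UNIV. M j k s * snd z $ k) = (\<Sum>l\<in>UNIV. N z l s * (\<Sum>k\<in>UNIV. snd z $ k * C z j k l))"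
      unfolding M_def sum_distrib_right sum_distrib_left by (subst sum.swap) (simp add: mult_ac)
    then show ?thesis using C_y(2)[OF z] by simp
  qed
  have M1: "(\<Sum>k\<in>UNIV. M s j k * snd z $ k) = (\<Sum>l\<in>UNIV. N0 z l * C z s j l)" for s
    unfolding M_def N0_def sum_distrib_right by (subst sum.swap) (simp add: mult_ac)
  \<comment> \<open>The explicit vector with components \<open>N z l j\<close> gives the sum the
    shape that \<open>fund_inv_fund\<close> inverts.\<close>
  have G1: "(\<Sum>k\<in>UNIV. G s j k * snd z $ k) = (\<Sum>l\<in>UNIV. fund L z $ s $ l * (\<chi> l. N z l j) $ l)" for s
    unfolding G_def N_sym[OF z] sum_distrib_right
    by (subst sum.swap) (simp add: sum_distrib_left mult_ac)
  have split: "(\<Sum>k\<in>UNIV. (2 * G s j k + M s j k - M j k s + M s k j) * snd z $ k)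
      = 2 * (\<Sum>k\<in>UNIV. G s j k * snd z $ k) + (\<Sum>k\<in>UNIV. M s j k * snd z $ k)
        - (\<Sum>k\<in>UNIV. M j k s * snd z $ k) + (\<Sum>k\<in>UNIV. M s k j * snd z $ k)" for s
    by (simp add: sum.distrib sum_subtractf sum_distrib_left algebra_simps)
  have "(\<Sum>k\<in>UNIV. formal_christoffel L z i j k * snd z $ k)
    = (\<Sum>s\<in>UNIV. fund_inv L z $ i $ s * (1/2 * (\<Sum>k\<in>UNIV. (2 * G s j k + M s j k - M j k s + M s k j) * snd z $ k)))"
    unfolding formal_christoffel_def P sum_distrib_right sum_distrib_left
    by (subst sum.swap) (simp add: mult_ac)
  also have "\<dots>
    = (\<Sum>s\<in>UNIV. fund_inv L z $ i $ s * (\<Sum>l\<in>UNIV. fund L z $ s $ l * (\<chi> l. N z l j) $ l))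
      + 1/2 * (\<Sum>s\<in>UNIV. fund_inv L z $ i $ s * (\<Sum>l\<in>UNIV. N0 z l * C z s j l))"
    unfolding split M0 M1 G1 by (simp add: sum.distrib sum_distrib_left algebra_simps)
  finally show ?thesis unfolding fund_inv_fund[OF z] by simp
qed

text \<open>Contracting \<open>christoffel_y\<close> with \<open>y\<close> once more, the surplus
  term vanishes because \<open>y\<close> now meets a slot of \<open>C\<close>.\<close>

lemma christoffel_yy:
  assumes z: "z \<in> S"
  shows "(\<Sum>r\<in>UNIV. \<Sum>s\<in>UNIV. formal_christoffel L z k r s * (snd z $ r * snd z $ s)) = N0 z k"
proof -
  have "(\<Sum>r\<in>UNIV. \<Sum>s\<in>UNIV. formal_christoffel L z k r s * (snd z $ r * snd z $ s))
      = (\<Sum>r\<in>UNIV. (\<Sum>s\<in>UNIV. formal_christoffel L z k r s * snd z $ s) * snd z $ r)"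
    by (simp add: sum_distrib_left mult_ac)
  also have "\<dots> = N0 z k + (\<Sum>r\<in>UNIV. \<Sum>s\<in>UNIV. \<Sum>l\<in>UNIV. 1/2 * fund_inv L z $ k $ s * N0 z l * (snd z $ r * C z s r l))"
    unfolding christoffel_y[OF z] N0_def[of z k] distrib_right sum.distrib
    by (simp add: sum_distrib_right sum_distrib_left mult_ac)
  also have "(\<Sum>r\<in>UNIV. \<Sum>s\<in>UNIV. \<Sum>l\<in>UNIV. 1/2 * fund_inv L z $ k $ s * N0 z l * (snd z $ r * C z s r l))
      = (\<Sum>s\<in>UNIV. \<Sum>r\<in>UNIV. \<Sum>l\<in>UNIV. 1/2 * fund_inv L z $ k $ s * N0 z l * (snd z $ r * C z s r l))"
    by (rule sum.swap)
  also have "\<dots> = (\<Sum>s\<in>UNIV. \<Sum>l\<in>UNIV. \<Sum>r\<in>UNIV. 1/2 * fund_inv L z $ k $ s * N0 z l * (snd z $ r * C z s r l))"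
    by (intro sum.cong refl sum.swap)
  also have "\<dots> = 0"
    unfolding sum_distrib_left[symmetric] C_y(2)[OF z] by simp
  finally show ?thesis by simp
qed

text \<open>The Cartan correction in \<open>nonlinear_conn\<close> is exactly the surplus in
  \<open>christoffel_y\<close>: by \<open>christoffel_yy\<close> its spray is \<open>N0\<close>, and
  the factor \<open>L z\<close> inside \<open>cartan\<close> cancels the division by
  \<open>L z\<close>.\<close>

lemma nonlinear_conn_eq:
  assumes z: "z \<in> S"
  shows "nonlinear_conn L z i j = N z i j"
proof -
  have L: "L z \<noteq> 0" using L_pos[OF z] by simp
  have "(\<Sum>k\<in>UNIV. \<Sum>r\<in>UNIV. \<Sum>s\<in>UNIV.
          cartan_up L z i j k * formal_christoffel L z k r s * (snd z $ r * snd z $ s / L z))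
     = (\<Sum>k\<in>UNIV. cartan_up L z i j k / L z *
          (\<Sum>r\<in>UNIV. \<Sum>s\<in>UNIV. formal_christoffel L z k r s * (snd z $ r * snd z $ s)))"
    by (simp add: sum_distrib_left mult_ac)
  also have "\<dots> = (\<Sum>k\<in>UNIV. \<Sum>l\<in>UNIV. 1/2 * fund_inv L z $ i $ l * (N0 z k * C z l j k))"
    unfolding christoffel_yy[OF z] cartan_up_def cartan_def using L
    by (simp add: sum_distrib_left sum_distrib_right sum_divide_distrib mult_ac)
  also have "\<dots> = 1/2 * (\<Sum>l\<in>UNIV. fund_inv L z $ i $ l * (\<Sum>k\<in>UNIV. N0 z k * C z l j k))"
    by (subst sum.swap) (simp add: sum_distrib_left mult_ac)
  finally show ?thesis
    unfolding nonlinear_conn_def christoffel_y[OF z] by simp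
qed

text \<open>Split \<open>w\<close> into its x and y parts. In the x part, the two
  \<open>\<Gamma>\<close> sums of \<open>dx_fund\<close> cancel the subtracted terms. What remains
  is \<open>C\<close> applied to the y part plus \<open>N\<close> times the x part, which is
  \<open>delta_y\<close> by \<open>nonlinear_conn_eq\<close>.\<close>

lemma chern_metric_equation:
  assumes z: "z \<in> S"
  shows "frechet_derivative (\<lambda>u. fund L u $ i $ j) (at z) w
       - (\<Sum>k\<in>UNIV. fund L z $ k $ j * (\<Sum>m\<in>UNIV. \<Gamma> (fst z) k i m * fst w $ m))
       - (\<Sum>k\<in>UNIV. fund L z $ i $ k * (\<Sum>m\<in>UNIV. \<Gamma> (fst z) k j m * fst w $ m))
     = 2 * (\<Sum>k\<in>UNIV. cartan L z i j k * (delta_y L z k w / L z))"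
proof -
  have L: "L z \<noteq> 0" using L_pos[OF z] by simp
  have g: "(\<Sum>k\<in>UNIV. fund L z $ a $ k * (\<Sum>m\<in>UNIV. \<Gamma> (fst z) k b m * fst w $ m))
     = (\<Sum>m\<in>UNIV. fst w $ m * (\<Sum>k\<in>UNIV. fund L z $ a $ k * \<Gamma> (fst z) k b m))" for a b
    unfolding sum_distrib_left by (subst sum.swap) (simp add: mult_ac)
  have c: "2 * (\<Sum>k\<in>UNIV. cartan L z i j k * (delta_y L z k w / L z))
     = (\<Sum>k\<in>UNIV. snd w $ k * C z i j k) + (\<Sum>k\<in>UNIV. \<Sum>m\<in>UNIV. fst w $ m * (N z k m * C z i j k))"
  proof -
    have "2 * (cartan L z i j k * (delta_y L z k w / L z))
        = snd w $ k * C z i j k + (\<Sum>m\<in>UNIV. N z k m * fst w $ m) * C z i j k" for k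
      unfolding delta_y_def dx_form_def nonlinear_conn_eq[OF z] cartan_def using L
      by (simp add: field_simps)
    then show ?thesis
      by (simp only: sum_distrib_left[of 2] sum.distrib sum_distrib_right) (simp add: mult_ac)
  qed
  have "frechet_derivative (\<lambda>u. fund L u $ i $ j) (at z) w
     = (\<Sum>m\<in>UNIV. fst w $ m * (\<Sum>l\<in>UNIV. fund L z $ i $ l * \<Gamma> (fst z) l j m))
      + (\<Sum>m\<in>UNIV. fst w $ m * (\<Sum>l\<in>UNIV. fund L z $ j $ l * \<Gamma> (fst z) l i m))
      + (\<Sum>m\<in>UNIV. fst w $ m * (\<Sum>k\<in>UNIV. N z k m * C z i j k)) + (\<Sum>k\<in>UNIV. snd w $ k * C z i j k)"
    unfolding frechet_derivative_partials[OF diff_S[OF smooth_fund z]] dx_fund[OF z]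
    by (simp only: distrib_left sum.distrib)
  moreover have "(\<Sum>m\<in>UNIV. fst w $ m * (\<Sum>k\<in>UNIV. N z k m * C z i j k))
      = (\<Sum>k\<in>UNIV. \<Sum>m\<in>UNIV. fst w $ m * (N z k m * C z i j k))"
    unfolding sum_distrib_left by (rule sum.swap)
  ultimately show ?thesis
    unfolding c g fund_sym[OF z, of _ j] by simp
qed

end

section \<open>Parallel transport along coordinate segments\<close>

locale atlas =
  fixes A :: "('p::{t2_space,second_countable_topology}, 'n::finite) chart set"
  assumes A: "smooth_atlas A"
begin

lemma open_cimg: "c \<in> A \<Longrightarrow> open (cimg c)"
  and chart_homeo: "c \<in> A \<Longrightarrow> homeomorphism (cdom c) (cimg c) (cmap c) (cinv c)"
  and open_cdom: "c \<in> A \<Longrightarrow> open (cdom c)"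
  using A unfolding smooth_atlas_def by blast+

lemma cinv_cmap: "c \<in> A \<Longrightarrow> p \<in> cdom c \<Longrightarrow> cinv c (cmap c p) = p"
  and cmap_cinv: "c \<in> A \<Longrightarrow> x \<in> cimg c \<Longrightarrow> cmap c (cinv c x) = x"
  and cinv_cdom: "c \<in> A \<Longrightarrow> x \<in> cimg c \<Longrightarrow> cinv c x \<in> cdom c"
  and continuous_cinv: "c \<in> A \<Longrightarrow> continuous_on (cimg c) (cinv c)"
  using chart_homeo[of c] unfolding homeomorphism_def by auto

definition overlap where "overlap c d = cmap c ` (cdom c \<inter> cdom d)"

lemma mem_overlap: "c \<in> A \<Longrightarrow> x \<in> overlap c d \<longleftrightarrow> x \<in> cimg c \<and> cinv c x \<in> cdom d"
  unfolding overlap_def by (auto simp: cinv_cmap cmap_cinv image_iff)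

lemma open_overlap:
  assumes "c \<in> A" "d \<in> A"
  shows "open (overlap c d)"
proof -
  have "overlap c d = cimg c \<inter> cinv c -` cdom d"
    using mem_overlap[OF assms(1)] by blast
  then show ?thesis
    using continuous_open_preimage[OF continuous_cinv open_cimg open_cdom] assms by simp
qed

lemma smooth_transition: "c \<in> A \<Longrightarrow> d \<in> A \<Longrightarrow> smooth_on (overlap c d) (transition c d)"
  using A unfolding smooth_atlas_def overlap_def by blast

lemma transition_has_derivative:
  "c \<in> A \<Longrightarrow> d \<in> A \<Longrightarrow> x \<in> overlap c d \<Longrightarrow>
    (transition c d has_derivative frechet_derivative (transition c d) (at x)) (at x)"
  using smooth_transition smooth_on_has_derivative by blast

text \<open>The cocycle identity, from the chain rule on the overlap. It makes the family
  \<open>tvec_of\<close> a genuine tangent vector.\<close>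

lemma transition_chain:
  assumes c: "c \<in> A" and d: "d \<in> A" and e: "e \<in> A" and x: "x \<in> overlap c d" "x \<in> overlap c e"
  shows "frechet_derivative (transition d e) (at (transition c d x)) (frechet_derivative (transition c d) (at x) v)
    = frechet_derivative (transition c e) (at x) v"
proof -
  have y: "transition c d x \<in> overlap d e"
    using x c d by (auto simp: mem_overlap transition_def cinv_cmap)
  have "(transition d e \<circ> transition c d has_derivative
      frechet_derivative (transition d e) (at (transition c d x)) \<circ> frechet_derivative (transition c d) (at x)) (at x)"
    using transition_has_derivative c d e x y by (intro diff_chain_at) auto
  then have "(transition c e has_derivative
      frechet_derivative (transition d e) (at (transition c d x)) \<circ> frechet_derivative (transition c d) (at x)) (at x)"
    by (rule has_derivative_transform_within_open[OF _ open_overlap[OF c d] x(1)])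
      (auto simp: mem_overlap[OF c] transition_def cinv_cmap[OF d])
  then show ?thesis by (simp add: frechet_derivative_at[symmetric])
qed

lemma transition_self:
  assumes c: "c \<in> A" and x: "x \<in> cimg c"
  shows "frechet_derivative (transition c c) (at x) v = v"
proof -
  have "((\<lambda>x. x) has_derivative (\<lambda>v. v)) (at x)" by simp
  then have "(transition c c has_derivative (\<lambda>v. v)) (at x)"
    by (rule has_derivative_transform_within_open[OF _ open_cimg[OF c] x])
      (simp add: transition_def cmap_cinv[OF c])
  then show ?thesis by (simp add: frechet_derivative_at[symmetric])
qed

lemma tvec_of_self: "c \<in> A \<Longrightarrow> x \<in> cimg c \<Longrightarrow> tvec_of A c x y c = y"
  by (simp add: tvec_of_def cinv_cdom transition_self)

lemma tvec_of_tangent_space: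
  assumes c: "c \<in> A" and x: "x \<in> cimg c"
  shows "tvec_of A c x y \<in> tangent_space A (cinv c x)"
  unfolding tangent_space_def
proof (intro CollectI conjI ballI allI impI)
  fix d e assume *: "d \<in> A" "e \<in> A" "cinv c x \<in> cdom d" "cinv c x \<in> cdom e"
  show "tvec_of A c x y e = frechet_derivative (transition d e) (at (cmap d (cinv c x))) (tvec_of A c x y d)"
    using transition_chain[OF c *(1,2), of x y] * x c
    by (simp add: tvec_of_def mem_overlap transition_def)
qed (auto simp: tvec_of_def)

lemma tvec_of_tangent:
  assumes c: "c \<in> A" and x: "x \<in> cimg c" and v: "v \<in> tangent_space A (cinv c x)"
  shows "tvec_of A c x (v c) = v"
proof
  fix d
  show "tvec_of A c x (v c) d = v d"
  proof (cases "d \<in> A \<and> cinv c x \<in> cdom d")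
    case True
    then have "v d = frechet_derivative (transition c d) (at (cmap c (cinv c x))) (v c)"
      using v c cinv_cdom[OF c x] unfolding tangent_space_def by blast
    then show ?thesis using True by (simp add: tvec_of_def cmap_cinv[OF c x])
  next
    case False
    then have "v d = 0" using v unfolding tangent_space_def by blast
    then show ?thesis using False by (auto simp: tvec_of_def)
  qed
qed

lemma tvec_of_scale:
  assumes c: "c \<in> A" and x: "x \<in> cimg c"
  shows "tvec_of A c x (t *\<^sub>R y) = (\<lambda>d. t *\<^sub>R tvec_of A c x y d)"
proof
  fix d
  show "tvec_of A c x (t *\<^sub>R y) d = t *\<^sub>R tvec_of A c x y d"
    using linear_scale[OF has_derivative_linear[OF transition_has_derivative[OF c, of d x]]] x c
    by (auto simp: tvec_of_def mem_overlap)
qed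

section \<open>Coordinate segments and parallel fields along them\<close>

text \<open>The lift carries the constant coordinate vector \<open>e\<close>, the simplest nowhere
  vanishing choice; a pull-back connection ignores the vertical velocity, so any lift defines the
  same transport.\<close>

lemma line_smooth_slit_lift:
  assumes c: "c \<in> A" and seg: "\<And>t. t \<in> {0..1} \<Longrightarrow> a + t *\<^sub>R b \<in> cimg c" and e: "e \<noteq> 0"
  shows "smooth_slit_lift A (\<lambda>t. cinv c (a + t *\<^sub>R b)) (\<lambda>t. tvec_of A c (a + t *\<^sub>R b) e)"
proof -
  define T where "T = (\<lambda>t. a + t *\<^sub>R b) -` cimg c"
  have cont: "continuous_on X (\<lambda>t::real. a + t *\<^sub>R b)" for X
    by (intro continuous_intros)
  have "open T"
    unfolding T_def by (rule open_vimage[OF open_cimg[OF c] cont])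
  moreover have "{0..1} \<subseteq> T" using seg by (auto simp: T_def)
  moreover have "continuous_on T (\<lambda>t. cinv c (a + t *\<^sub>R b))"
    by (rule continuous_on_compose2[OF continuous_cinv[OF c] cont]) (auto simp: T_def)
  moreover have "tvec_of A c (a + t *\<^sub>R b) e \<in> tangent_space A (cinv c (a + t *\<^sub>R b))"
      "tvec_of A c (a + t *\<^sub>R b) e \<noteq> zero_tvec" if "t \<in> T" for t
    using that tvec_of_tangent_space[OF c] tvec_of_self[OF c, of "a + t *\<^sub>R b" e] e by (auto simp: T_def)
  moreover have "smooth_on {t \<in> T. cinv c (a + t *\<^sub>R b) \<in> cdom d}
      (\<lambda>t. nat_coords d (cinv c (a + t *\<^sub>R b)) (tvec_of A c (a + t *\<^sub>R b) e))" if d: "d \<in> A" for d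
  proof -
    have eq: "{t \<in> T. cinv c (a + t *\<^sub>R b) \<in> cdom d} = (\<lambda>t. a + t *\<^sub>R b) -` overlap c d" (is "?T = _")
      by (auto simp: T_def mem_overlap[OF c])
    have op: "open ?T"
      unfolding eq by (rule open_vimage[OF open_overlap[OF c d] cont])
    have lin: "bounded_linear (\<lambda>t. t *\<^sub>R b)" by (rule bounded_linear_scaleR_left)
    have "smooth_on ?T (\<lambda>t. (transition c d (a + t *\<^sub>R b), frechet_derivative (transition c d) (at (a + t *\<^sub>R b)) e))"
      using smooth_transition[OF c d]
      by (intro smooth_on_Pair op smooth_on_compose_affine[OF lin op]
          smooth_on_compose_affine[OF lin op smooth_on_frechet_derivative]) (auto simp: eq)
    then show ?thesis
      by (rule smooth_on_cong[OF op, rotated]) (use d in \<open>auto simp: nat_coords_def transition_def tvec_of_def\<close>)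
  qed
  ultimately show ?thesis
    unfolding smooth_slit_lift_def by blast
qed

lemma christoffel_form_scale: "christoffel_form \<Gamma> c x (t *\<^sub>R \<xi>) = t *\<^sub>R christoffel_form \<Gamma> c x \<xi>"
  by (simp add: christoffel_form_def vec_eq_iff sum_distrib_left mult_ac)

text \<open>Invariance of the indicatrix only concerns the end points of a path. Rescaling the
  parameter by \<open>\<tau>\<close> makes every intermediate point an end point; linearity of the
  connection form in the velocity absorbs the factor from the chain rule.\<close>

lemma parallel_along_initial_segment:
  assumes lift: "smooth_slit_lift A \<gamma> V" and par: "parallel_along A (pullback_connection \<Gamma>) \<gamma> V S"
    and \<tau>: "0 \<le> \<tau>" "\<tau> \<le> 1"
  shows "parallel_along A (pullback_connection \<Gamma>) (\<lambda>t. \<gamma> (\<tau> * t)) (\<lambda>t. V (\<tau> * t)) (\<lambda>t. S (\<tau> * t))"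
  unfolding parallel_along_def
proof (intro ballI conjI impI)
  fix t :: real assume t: "t \<in> {0..1}"
  then have \<tau>t: "\<tau> * t \<in> {0..1}" using \<tau> by (auto intro: mult_le_one)
  then show "S (\<tau> * t) \<in> tangent_space A (\<gamma> (\<tau> * t))"
    using par by (simp add: parallel_along_def)
  fix c assume c: "c \<in> A" and p: "\<gamma> (\<tau> * t) \<in> cdom c"
  obtain T where T: "open T" "{0..1} \<subseteq> T" "continuous_on T \<gamma>"
    "smooth_on {t\<in>T. \<gamma> t \<in> cdom c} (\<lambda>t. nat_coords c (\<gamma> t) (V t))"
    using lift c unfolding smooth_slit_lift_def by blast
  let ?f = "\<lambda>s. nat_coords c (\<gamma> s) (V s)"
  have "?f differentiable (at (\<tau> * t))"
    using smooth_on_differentiable[OF T(4)] T(2) \<tau>t p by auto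
  then have f: "(?f has_vector_derivative vector_derivative ?f (at (\<tau> * t))) (at (\<tau> * t))"
    by (simp flip: vector_derivative_works)
  have sc: "((\<lambda>s. \<tau> * s) has_vector_derivative \<tau>) (at t within X)" for X
    by (auto intro!: derivative_eq_intros simp: has_vector_derivative_def)
  have "(?f \<circ> (\<lambda>s. \<tau> * s) has_vector_derivative \<tau> *\<^sub>R vector_derivative ?f (at (\<tau> * t))) (at t)"
    by (rule vector_diff_chain_at[OF sc f])
  then have vel: "vector_derivative (\<lambda>s. ?f (\<tau> * s)) (at t) = \<tau> *\<^sub>R vector_derivative ?f (at (\<tau> * t))"
    by (intro vector_derivative_at) (simp add: o_def)
  have "((\<lambda>s. S s c) has_vector_derivative
      - (pullback_connection \<Gamma> c (?f (\<tau> * t)) (vector_derivative ?f (at (\<tau> * t))) *v S (\<tau> * t) c))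
      (at (\<tau> * t) within {0..1})"
    using par c p \<tau>t unfolding parallel_along_def by blast
  \<comment> \<open>The chain rule within a set requires differentiability only on the image of the
    unit interval, that is up to \<open>\<tau>\<close>.\<close>
  then have "((\<lambda>s. S s c) has_vector_derivative
      - (pullback_connection \<Gamma> c (?f (\<tau> * t)) (vector_derivative ?f (at (\<tau> * t))) *v S (\<tau> * t) c))
      (at (\<tau> * t) within (\<lambda>s. \<tau> * s) ` {0..1})"
    by (rule has_vector_derivative_within_subset) (use \<tau> in \<open>auto intro: mult_le_one\<close>)
  from vector_diff_chain_within[OF sc this]
  show "((\<lambda>s. S (\<tau> * s) c) has_vector_derivative
      - (pullback_connection \<Gamma> c (?f (\<tau> * t)) (vector_derivative (\<lambda>s. ?f (\<tau> * s)) (at t)) *v S (\<tau> * t) c))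
      (at t within {0..1})"
    unfolding vel
    by (simp add: o_def pullback_connection_def christoffel_form_scale scaleR_matrix_vector_assoc[symmetric])
qed

lemma indicatrix_invariant_deriv_unit_small:
  assumes F: "indicatrix_invariant A F (pullback_connection \<Gamma>)"
    and c: "c \<in> A" and seg: "\<And>t. t \<in> {0..1} \<Longrightarrow> x - b + t *\<^sub>R b \<in> cimg c" and y: "y \<noteq> 0"
    and unit: "local_fun A F c (x, y) = 1" and diff: "local_fun A F c differentiable (at (x, y))"
  shows "frechet_derivative (local_fun A F c) (at (x, y)) (b, - (christoffel_form \<Gamma> c x b *v y)) = 0"
proof -
  \<comment> \<open>The segment ends at \<open>x\<close>, so surjectivity of the transport can
    prescribe the final value \<open>y\<close> of a parallel field.\<close>
  define \<sigma> where "\<sigma> t = x - b + t *\<^sub>R b" for t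
  define \<gamma> where "\<gamma> t = cinv c (\<sigma> t)" for t
  define V where "V t = tvec_of A c (\<sigma> t) y" for t
  let ?P = "pullback_connection \<Gamma>" and ?L = "local_fun A F c"
  have \<sigma>: "\<sigma> t \<in> cimg c" if "t \<in> {0..1}" for t using seg[OF that] by (simp add: \<sigma>_def)
  have \<sigma>1: "\<sigma> 1 = x" by (simp add: \<sigma>_def)
  then have x: "x \<in> cimg c" using \<sigma>[of 1] by simp
  have lift: "smooth_slit_lift A (\<lambda>t. \<gamma> (\<tau> * t)) (\<lambda>t. V (\<tau> * t))" if "0 \<le> \<tau>" "\<tau> \<le> 1" for \<tau>
    using line_smooth_slit_lift[OF c, of "x - b" "\<tau> *\<^sub>R b" y] seg[of "\<tau> * _"] that y
    by (simp add: \<gamma>_def V_def \<sigma>_def mult_le_one mult.commute)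
  have inv: "parallel_transport A ?P (\<lambda>t. \<gamma> (\<tau> * t)) (\<lambda>t. V (\<tau> * t)) `` indicatrix A F (\<gamma> 0) = indicatrix A F (\<gamma> \<tau>)"
    if "0 \<le> \<tau>" "\<tau> \<le> 1" for \<tau>
    using F lift[OF that] unfolding indicatrix_invariant_def by fastforce
  have "V 1 \<in> indicatrix A F (\<gamma> 1)"
    using unit tvec_of_tangent_space[OF c x] by (simp add: indicatrix_def V_def \<gamma>_def \<sigma>1 local_fun_def)
  then have "V 1 \<in> parallel_transport A ?P \<gamma> V `` indicatrix A F (\<gamma> 0)"
    using inv[of 1] by simp
  then obtain S where S: "parallel_along A ?P \<gamma> V S" "S 0 \<in> indicatrix A F (\<gamma> 0)" "S 1 = V 1"
    unfolding parallel_transport_def by auto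
  \<comment> \<open>Apply invariance to the initial segment up to \<open>t\<close>: the start
    \<open>S 0\<close> lies on the indicatrix, hence so does its transport
    \<open>S t\<close>.\<close>
  have ind: "S t \<in> indicatrix A F (\<gamma> t)" if "t \<in> {0..1}" for t
  proof -
    have "parallel_along A ?P (\<lambda>s. \<gamma> (t * s)) (\<lambda>s. V (t * s)) (\<lambda>s. S (t * s))"
      using parallel_along_initial_segment[OF _ S(1), of t] lift[of 1] that by simp
    then have "(S 0, S t) \<in> parallel_transport A ?P (\<lambda>s. \<gamma> (t * s)) (\<lambda>s. V (t * s))"
      unfolding parallel_transport_def by (intro CollectI exI[of _ "\<lambda>s. S (t * s)"]) simp
    then show ?thesis using inv[of t] S(2) that by auto
  qed
  have const: "?L (\<sigma> t, S t c) = 1" if "t \<in> {0..1}" for t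
    using ind[OF that] tvec_of_tangent[OF c \<sigma>[OF that], of "S t"]
    by (auto simp: indicatrix_def local_fun_def \<gamma>_def)
  have S1: "S 1 c = y" using S(3) tvec_of_self[OF c x] by (simp add: V_def \<sigma>1)
  have \<sigma>': "(\<sigma> has_vector_derivative b) (at t within X)" for t X
    unfolding \<sigma>_def has_vector_derivative_def by (auto intro!: derivative_eq_intros)
  have p1: "\<gamma> 1 \<in> cdom c" using cinv_cdom[OF c x] by (simp add: \<gamma>_def \<sigma>1)
  \<comment> \<open>The lift reads \<open>(\<sigma> s, y)\<close> while \<open>\<sigma> s\<close>
    stays in the open chart image, hence also slightly beyond 1. This supplies the two-sided
    velocity occurring in \<open>parallel_along\<close>.\<close>
  have "((\<lambda>s. (\<sigma> s, y)) has_vector_derivative (b, 0)) (at 1)"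
    using \<sigma>' unfolding has_vector_derivative_def by (auto intro!: derivative_eq_intros)
  then have "((\<lambda>s. nat_coords c (\<gamma> s) (V s)) has_vector_derivative (b, 0)) (at 1)"
    unfolding has_vector_derivative_def
  proof (rule has_derivative_transform_within_open[where s = "\<sigma> -` cimg c"])
    show "open (\<sigma> -` cimg c)"
      unfolding \<sigma>_def by (intro open_vimage open_cimg c continuous_intros)
  qed (use \<sigma>[of 1] c in \<open>auto simp: nat_coords_def \<gamma>_def V_def cmap_cinv tvec_of_self\<close>)
  then have vel: "vector_derivative (\<lambda>s. nat_coords c (\<gamma> s) (V s)) (at 1) = (b, 0)"
    by (rule vector_derivative_at)
  have S': "((\<lambda>s. S s c) has_vector_derivative - (christoffel_form \<Gamma> c x b *v y)) (at 1 within {0..1})"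
  proof -
    have "((\<lambda>s. S s c) has_vector_derivative
        - (?P c (nat_coords c (\<gamma> 1) (V 1)) (vector_derivative (\<lambda>s. nat_coords c (\<gamma> s) (V s)) (at 1)) *v S 1 c))
        (at 1 within {0..1})"
      using S(1)[unfolded parallel_along_def, rule_format, of 1] c p1 by simp
    then show ?thesis
      unfolding vel S1 pullback_connection_def
      by (simp add: nat_coords_def \<gamma>_def \<sigma>1 cmap_cinv[OF c x])
  qed
  have "((\<lambda>t. (\<sigma> t, S t c)) has_derivative (\<lambda>h. (h *\<^sub>R b, h *\<^sub>R - (christoffel_form \<Gamma> c x b *v y)))) (at 1 within {0..1})"
    using \<sigma>' S' unfolding has_vector_derivative_def by (rule has_derivative_Pair)
  moreover have "(?L has_derivative frechet_derivative ?L (at (x, y))) (at (\<sigma> 1, S 1 c))"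
    using diff by (simp add: \<sigma>1 S1 flip: frechet_derivative_works)
  ultimately have "((\<lambda>t. ?L (\<sigma> t, S t c)) has_derivative (\<lambda>h. frechet_derivative ?L (at (x, y))
      (h *\<^sub>R b, h *\<^sub>R - (christoffel_form \<Gamma> c x b *v y)))) (at 1 within {0..1})"
    by (rule has_derivative_compose)
  \<comment> \<open>The composite equals 1 on the whole interval; derivatives within a nondegenerate
    closed interval are unique even at its end point, so the chain-rule expression vanishes.\<close>
  then have "((\<lambda>t. 1) has_derivative (\<lambda>h. frechet_derivative ?L (at (x, y))
      (h *\<^sub>R b, h *\<^sub>R - (christoffel_form \<Gamma> c x b *v y)))) (at 1 within {0..1::real})"
    by (rule has_derivative_transform[rotated -1]) (auto simp: const)
  then have "(\<lambda>h. frechet_derivative ?L (at (x, y)) (h *\<^sub>R b, h *\<^sub>R - (christoffel_form \<Gamma> c x b *v y))) = (\<lambda>h. 0)"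
    using frechet_derivative_unique_within_closed_interval[of 0 1 "1::real", OF _ _ _ has_derivative_const] by simp
  from fun_cong[OF this, of 1] show ?thesis by simp
qed

lemma indicatrix_invariant_deriv_unit:
  assumes F: "indicatrix_invariant A F (pullback_connection \<Gamma>)"
    and c: "c \<in> A" and x: "x \<in> cimg c" and y: "y \<noteq> 0"
    and unit: "local_fun A F c (x, y) = 1" and diff: "local_fun A F c differentiable (at (x, y))"
  shows "frechet_derivative (local_fun A F c) (at (x, y)) (\<xi>, - (christoffel_form \<Gamma> c x \<xi> *v y)) = 0"
proof -
  obtain r where r: "r > 0" "cball x r \<subseteq> cimg c"
    using open_cimg[OF c] x open_contains_cball by blast
  \<comment> \<open>Shrinking \<open>\<xi>\<close> keeps the segment inside a ball in the chart
    image, and linearity of the derivative undoes the scaling. The summand 1 covers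
    \<open>\<xi> = 0\<close>.\<close>
  define \<epsilon> where "\<epsilon> = r / (norm \<xi> + 1)"
  have n: "norm \<xi> + 1 > 0" by (rule add_nonneg_pos) simp_all
  have \<epsilon>: "\<epsilon> > 0" "\<epsilon> * norm \<xi> \<le> r"
    using r(1) n by (simp_all add: \<epsilon>_def pos_divide_le_eq)
  have "x - \<epsilon> *\<^sub>R \<xi> + t *\<^sub>R \<epsilon> *\<^sub>R \<xi> \<in> cimg c" if "t \<in> {0..1}" for t
  proof -
    have "norm (x - (x - \<epsilon> *\<^sub>R \<xi> + t *\<^sub>R \<epsilon> *\<^sub>R \<xi>)) = norm ((1 - t) *\<^sub>R \<epsilon> *\<^sub>R \<xi>)"
      by (simp add: algebra_simps)
    also have "\<dots> = (1 - t) * (\<epsilon> * norm \<xi>)" using that \<epsilon> by simp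
    also have "\<dots> \<le> 1 * (\<epsilon> * norm \<xi>)" using that \<epsilon> by (intro mult_right_mono) auto
    finally show ?thesis using \<epsilon> r(2) by (auto simp: dist_norm subset_iff)
  qed
  from indicatrix_invariant_deriv_unit_small[OF F c this y unit diff]
  have "frechet_derivative (local_fun A F c) (at (x, y)) (\<epsilon> *\<^sub>R (\<xi>, - (christoffel_form \<Gamma> c x \<xi> *v y))) = 0"
    by (simp add: christoffel_form_scale scaleR_matrix_vector_assoc[symmetric])
  then show ?thesis
    unfolding linear_scale[OF linear_frechet_derivative[OF diff]] using \<epsilon>(1) by simp
qed

section \<open>The pull-back of the Levi-Civita connection\<close>

lemma slit_iff: "z \<in> slit c \<longleftrightarrow> fst z \<in> cimg c \<and> snd z \<noteq> 0"
  by (cases z) (simp add: slit_def)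

lemma open_slit: "c \<in> A \<Longrightarrow> open (slit c)"
  unfolding slit_def by (intro open_Times open_cimg open_Diff open_UNIV closed_singleton)

lemma finsler_chart_local_fun:
  assumes F: "finsler_structure A F" and c: "c \<in> A"
  shows "finsler_chart (cimg c) (local_fun A F c) (slit c)"
proof
  show "slit c = cimg c \<times> (UNIV - {0})" by (simp add: slit_def)
  show "open (cimg c)" by (rule open_cimg[OF c])
  show "smooth_on (slit c) (local_fun A F c)"
    using F c unfolding finsler_structure_def by blast
  show "local_fun A F c z \<ge> 0" if "z \<in> slit c" for z
    using F tvec_of_tangent_space[OF c, of "fst z"] that
    by (auto simp: finsler_structure_def local_fun_def slit_iff split: prod.splits)
  show "local_fun A F c (x, t *\<^sub>R y) = t * local_fun A F c (x, y)" if "(x, y) \<in> slit c" "t > 0" for x y t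
    using F tvec_of_tangent_space[OF c, of x y] that tvec_of_scale[OF c, of x t y]
    by (auto simp: finsler_structure_def local_fun_def slit_iff)
  show "(\<Sum>i\<in>UNIV. \<Sum>j\<in>UNIV. fund (local_fun A F c) z $ i $ j * w $ i * w $ j) > 0"
    if "z \<in> slit c" "w \<noteq> 0" for z w
    using F c that unfolding finsler_structure_def by blast
qed

lemma indicatrix_invariant_deriv:
  assumes F: "finsler_structure A F" and inv: "indicatrix_invariant A F (pullback_connection \<Gamma>)"
    and c: "c \<in> A" and z: "(x, y) \<in> slit c"
  shows "frechet_derivative (local_fun A F c) (at (x, y)) (\<xi>, - (christoffel_form \<Gamma> c x \<xi> *v y)) = 0"
proof -
  let ?L = "local_fun A F c"
  interpret finsler_chart "cimg c" ?L "slit c"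
    by (rule finsler_chart_local_fun[OF F c])
  \<comment> \<open>Homogeneity moves \<open>y\<close> onto the indicatrix; the equation proved
    there scales back to \<open>y\<close>.\<close>
  define t where "t = 1 / ?L (x, y)"
  have t: "t > 0" "?L (x, t *\<^sub>R y) = 1"
    using L_pos[OF z] by (auto simp: t_def L_hom[OF z])
  have zt: "(x, t *\<^sub>R y) \<in> slit c" by (rule scale_S[OF z t(1)])
  have "frechet_derivative ?L (at (x, t *\<^sub>R y)) (\<xi>, - (christoffel_form \<Gamma> c x \<xi> *v (t *\<^sub>R y))) = 0"
    using zt by (intro indicatrix_invariant_deriv_unit[OF inv c _ _ t(2) diff_S[OF smooth_L]]) (auto simp: slit_iff)
  moreover have "frechet_derivative ?L (at (x, t *\<^sub>R y)) (\<xi>, t *\<^sub>R - (christoffel_form \<Gamma> c x \<xi> *v y))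
      = t ^ 1 * frechet_derivative ?L (at (x, y)) (\<xi>, - (christoffel_form \<Gamma> c x \<xi> *v y))"
    by (rule frechet_derivative_homogeneous[OF open_S z diff_S[OF smooth_L] t(1) zt])
      (auto simp: L_hom t(1))
  ultimately show ?thesis
    using t(1) by (simp add: matrix_vector_mult_scaleR)
qed

lemma finsler_invariant_chart_local_fun:
  assumes F: "finsler_structure A F" and inv: "indicatrix_invariant A F (pullback_connection \<Gamma>)"
    and h: "levi_civita A h \<Gamma>" and c: "c \<in> A"
  shows "finsler_invariant_chart (cimg c) (local_fun A F c) (slit c) (\<Gamma> c)"
proof -
  let ?L = "local_fun A F c"
  interpret finsler_chart "cimg c" ?L "slit c"
    by (rule finsler_chart_local_fun[OF F c])
  show ?thesis
  proof
    show "smooth_on (cimg c) (\<lambda>x. \<Gamma> c x i j k)" for i j k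
      using h c unfolding levi_civita_def affine_connection_def by blast
    show "\<Gamma> c x i j k = \<Gamma> c x i k j" if "x \<in> cimg c" for x i j k
      using h c that unfolding levi_civita_def by blast
    show "dx_partial k (\<lambda>u. (?L u)\<^sup>2) z
        = (\<Sum>l\<in>UNIV. (\<Sum>m\<in>UNIV. \<Gamma> c (fst z) l m k * snd z $ m) * dy_partial l (\<lambda>u. (?L u)\<^sup>2) z)"
      if z: "z \<in> slit c" for z k
    proof -
      \<comment> \<open>The horizontal lift of the \<open>k\<close>-th coordinate field at
        \<open>z\<close>. The derivative of \<open>?L\<close>, and hence of its square, vanishes on
        it; expanding in partial derivatives gives the claim.\<close>
      define w where "w = (axis k (1::real), - (christoffel_form \<Gamma> c (fst z) (axis k 1) *v snd z))"
      have dL: "?L differentiable (at z)" by (rule diff_S[OF smooth_L z])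
      have "frechet_derivative ?L (at z) w = 0"
        using indicatrix_invariant_deriv[OF F inv c, of "fst z" "snd z"] z by (simp add: w_def)
      then have 0: "frechet_derivative (\<lambda>u. (?L u)\<^sup>2) (at z) w = 0"
        by (simp add: power2_eq_square frechet_derivative_mult[OF dL dL])
      have "(\<lambda>u. (?L u)\<^sup>2) differentiable (at z)"
        using diff_S[OF smooth_E z] by (simp add: E_def[abs_def])
      from frechet_derivative_partials[OF this, of w] show ?thesis
        unfolding 0
        by (simp add: w_def christoffel_form_def matrix_vector_mult_def axis_def if_distrib if_distribR
            sum_negf cong: if_cong)
    qed
  qed
qed

section \<open>The pull-back as a global linear connection and as the Chern connection\<close>

lemma smooth_jacobian:
  assumes c: "c \<in> A" and d: "d \<in> A"
  shows "smooth_on (overlap c d) (jacobian c d)"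
proof (intro smooth_on_vec[OF open_overlap[OF c d]])
  fix i j
  have "bounded_linear (\<lambda>v :: real^'n. v $ i)" by (rule bounded_linear_vec_nth)
  from smooth_on_bounded_linear[OF this open_overlap[OF c d] smooth_on_frechet_derivative[OF smooth_transition[OF c d]]]
  show "smooth_on (overlap c d) (\<lambda>z. jacobian c d z $ i $ j)"
    by (simp add: jacobian_def matrix_def)
qed

lemma jacobian_mult: "c \<in> A \<Longrightarrow> d \<in> A \<Longrightarrow> x \<in> overlap c d \<Longrightarrow>
    jacobian c d x *v v = frechet_derivative (transition c d) (at x) v"
  unfolding jacobian_def
  by (intro matrix_works) (simp add: linear_matrix_vector_mul_eq has_derivative_linear[OF transition_has_derivative])

text \<open>The pulled-back forms see only base points and horizontal components, and the base
  component of the differential of \<open>nat_transition\<close> is the Jacobian. The gauge law thus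
  reduces to that of the affine connection.\<close>

lemma pullback_linear_connection:
  assumes \<Gamma>: "affine_connection A \<Gamma>"
  shows "linear_connection A (pullback_connection \<Gamma>)"
  unfolding linear_connection_def
proof (intro conjI ballI allI impI)
  fix c z assume c: "c \<in> A" and z: "z \<in> slit c"
  show "linear (pullback_connection \<Gamma> c z)"
    unfolding pullback_connection_def
    by (rule linearI) (simp_all add: christoffel_form_def vec_eq_iff algebra_simps sum.distrib sum_distrib_left)
next
  fix c and w :: "(real^'n) \<times> (real^'n)" assume c: "c \<in> A"
  \<comment> \<open>The summand 0 presents \<open>fst z\<close> as an affine map, as
    \<open>smooth_on_compose_affine\<close> expects.\<close>
  have "smooth_on (slit c) (\<lambda>z. \<Gamma> c (0 + fst z) i j k)" for i j k
    using \<Gamma> c unfolding affine_connection_def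
    by (intro smooth_on_compose_affine[OF bounded_linear_fst open_slit[OF c], of "cimg c" "\<lambda>x. \<Gamma> c x i j k"])
      (auto simp: slit_iff)
  then show "smooth_on (slit c) (\<lambda>z. pullback_connection \<Gamma> c z w)"
    unfolding pullback_connection_def christoffel_form_def
    by (intro smooth_on_vec[OF open_slit[OF c]])
      (auto intro!: smooth_on_sum smooth_on_mult open_slit c smooth_on_const)
next
  fix c d z and w :: "(real^'n) \<times> (real^'n)"
  assume c: "c \<in> A" and d: "d \<in> A" and z: "z \<in> slit c" and p: "cinv c (fst z) \<in> cdom d"
  let ?x = "fst z" and ?J = "jacobian c d"
  have x: "?x \<in> overlap c d" using z p c by (simp add: mem_overlap slit_iff)
  have J: "?J differentiable (at ?x)"
    by (rule smooth_on_differentiable[OF smooth_jacobian[OF c d] x])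
  have J': "frechet_derivative (\<lambda>u. ?J (fst u)) (at z) w = frechet_derivative ?J (at ?x) (fst w)"
    using frechet_derivative_at[OF has_derivative_fst_compose[OF J], symmetric] by simp
  have tr: "((\<lambda>u. transition c d (fst u)) has_derivative
      (\<lambda>w. frechet_derivative (transition c d) (at ?x) (fst w))) (at z)"
    by (rule has_derivative_fst_compose) (rule smooth_on_differentiable[OF smooth_transition[OF c d] x])
  \<comment> \<open>Differentiability of the fibre component ensures that the derivative of the pair
    exists. Its value \<open>D\<close> may stay abstract, since \<open>pullback_connection\<close>
    reads only the first component.\<close>
  have "(\<lambda>u. ?J (fst u) *v snd u) differentiable (at z)"
  proof -
    have Jij: "(\<lambda>u. ?J (fst u) $ i $ j) differentiable (at z)" for i j
      by (rule differentiableI[OF bounded_linear.has_derivative[OF bounded_linear_vec_nth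
              bounded_linear.has_derivative[OF bounded_linear_vec_nth has_derivative_fst_compose[OF J]]]])
    have y: "(\<lambda>u. snd u $ j) differentiable (at z)" for j
      by (rule differentiableI[OF bounded_linear_imp_has_derivative[OF
              bounded_linear_compose[OF bounded_linear_vec_nth bounded_linear_snd]]])
    have "(\<lambda>u. \<Sum>i\<in>UNIV. (\<Sum>j\<in>UNIV. ?J (fst u) $ i $ j * snd u $ j) *\<^sub>R axis i (1::real)) differentiable (at z)"
      by (intro differentiable_sum differentiable_scaleR differentiable_mult Jij y differentiable_const ballI finite)
    moreover have "(\<Sum>i\<in>UNIV. (\<Sum>j\<in>UNIV. ?J (fst u) $ i $ j * snd u $ j) *\<^sub>R axis i (1::real)) = ?J (fst u) *v snd u" for u
      by (simp add: vec_eq_iff matrix_vector_mult_def axis_def if_distrib if_distribR cong: if_cong)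
    ultimately show ?thesis by simp
  qed
  then obtain D where D: "((\<lambda>u. ?J (fst u) *v snd u) has_derivative D) (at z)"
    unfolding differentiable_def by blast
  have "(nat_transition c d has_derivative
      (\<lambda>w. (frechet_derivative (transition c d) (at ?x) (fst w), D w))) (at z)"
    using has_derivative_Pair[OF tr D] by (simp add: nat_transition_def case_prod_beta')
  then have n: "frechet_derivative (nat_transition c d) (at z) w = (?J ?x *v fst w, D w)"
    by (simp add: frechet_derivative_at[symmetric] jacobian_mult[OF c d x])
  show "?J ?x ** pullback_connection \<Gamma> c z w =
      frechet_derivative (\<lambda>u. ?J (fst u)) (at z) w
      + pullback_connection \<Gamma> d (nat_transition c d z) (frechet_derivative (nat_transition c d) (at z) w) ** ?J ?x"
  proof -
    have "?J ?x ** christoffel_form \<Gamma> c ?x (fst w) = frechet_derivative ?J (at ?x) (fst w)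
        + christoffel_form \<Gamma> d (transition c d ?x) (?J ?x *v fst w) ** ?J ?x"
      using \<Gamma> c d x unfolding affine_connection_def overlap_def by blast
    then show ?thesis
      unfolding n J' pullback_connection_def by (simp add: nat_transition_def case_prod_beta)
  qed
qed

lemma pullback_chern_connection:
  assumes F: "finsler_structure A F" and inv: "indicatrix_invariant A F (pullback_connection \<Gamma>)"
    and h: "levi_civita A h \<Gamma>"
  shows "chern_connection A F (pullback_connection \<Gamma>)"
  unfolding chern_connection_def Let_def
proof (intro conjI ballI allI)
  show "linear_connection A (pullback_connection \<Gamma>)"
    using h by (intro pullback_linear_connection) (simp add: levi_civita_def)
next
  fix c z and i :: 'n and u v :: "(real^'n) \<times> (real^'n)" assume c: "c \<in> A" and z: "z \<in> slit c"
  have sym: "\<Gamma> c (fst z) i j k = \<Gamma> c (fst z) i k j" for j k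
    using h c z unfolding levi_civita_def slit_iff by blast
  \<comment> \<open>The torsion condition is the symmetry of the coefficients in the lower indices,
    seen after exchanging the two sums.\<close>
  have "(\<Sum>j\<in>UNIV. \<Sum>k\<in>UNIV. fst v $ j * (\<Gamma> c (fst z) i j k * fst u $ k))
      = (\<Sum>j\<in>UNIV. \<Sum>k\<in>UNIV. fst u $ j * (\<Gamma> c (fst z) i j k * fst v $ k))"
    by (subst sum.swap, subst sym) (simp add: mult_ac)
  then show "(\<Sum>j\<in>UNIV. wedge1 (dx_form j) (\<lambda>w. pullback_connection \<Gamma> c z w $ i $ j) u v) = 0"
    by (simp add: wedge1_def dx_form_def pullback_connection_def christoffel_form_def
        sum_subtractf sum_distrib_left)
next
  fix c z i j w assume c: "c \<in> A" and z: "z \<in> slit c"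
  let ?L = "local_fun A F c"
  interpret finsler_invariant_chart "cimg c" ?L "slit c" "\<Gamma> c"
    by (rule finsler_invariant_chart_local_fun[OF F inv h c])
  show "frechet_derivative (\<lambda>u. fund ?L u $ i $ j) (at z) w
      - (\<Sum>k\<in>UNIV. fund ?L z $ k $ j * pullback_connection \<Gamma> c z w $ k $ i)
      - (\<Sum>k\<in>UNIV. fund ?L z $ i $ k * pullback_connection \<Gamma> c z w $ k $ j)
    = 2 * (\<Sum>k\<in>UNIV. cartan ?L z i j k * (delta_y ?L z k w / ?L z))"
    using chern_metric_equation[OF z, of i j w]
    by (simp add: pullback_connection_def christoffel_form_def)
qed

end

theorem proposition3p7:
  fixes A :: "('p::{t2_space,second_countable_topology}, 'n::finite) chart set"
    and F :: "'p \<Rightarrow> ('p, 'n) tvec \<Rightarrow> real"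
  assumes "smooth_atlas A"
    and "finsler_structure A F"
    and "\<exists>h \<Gamma>. riemannian_metric A h \<and> levi_civita A h \<Gamma> \<and>
           indicatrix_invariant A F (pullback_connection \<Gamma>)"
  shows "berwald A F"
proof -
  interpret atlas A by unfold_locales (rule assms(1))
  obtain h \<Gamma> where "levi_civita A h \<Gamma>" "indicatrix_invariant A F (pullback_connection \<Gamma>)"
    using assms(3) by blast
  then have "chern_connection A F (pullback_connection \<Gamma>)"
    by (intro pullback_chern_connection assms(2))
  \<comment> \<open>The pull-back is the witness in \<open>berwald\<close>: its coefficients are
    evaluated at \<open>fst z\<close> alone, so they agree for all \<open>y\<close> over the same
    \<open>x\<close>.\<close>
  then show ?thesis
    unfolding berwald_def by (auto simp: conn_coeff_def pullback_connection_def)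
qed

end
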